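(* Let $L(G)$ be the directed metric tree associated with a directed tree $G=(V,E)$, $E=\{e_i\}_{i\in I}$, let $\rho=(\rho_i)_{i\in I}$ be a weight on $L(G)$, and let $M\ge 1$ and $w\in\mathbb{R}$. Let $\{T_t\}_{t\ge 0}$ be the left translation family on $L(G)$. (a) The following assertions are equivalent: (i) $\{T_t\}_{t\ge 0}$ is a strongly continuous semigroup on $L^1_\rho(L(G))$ such that $\|T_t\|\le Me^{wt}$ for all $t\ge 0$; (ii) for all $i\in I$, all $t\ge 0$ and a.e. $s\in[0,1)$, $$\rho_i(s)\le Me^{wt}\inf_{j\in M_{n(t,s)}(i)}\rho_j\big(s+t-n(t,s)\big).$$ (b) Let $1<p<\infty$. The following assertions are equivalent: (i) $\{T_t\}_{t\ge 0}$ is a strongly continuous semigroup on $L^p_\rho(L(G))$ such that $\|T_t\|\le Me^{wt}$ for all $t\ge 0$; (ii) for all $i\in I$, all $t\ge 0$ and a.e. $s\in[0,1)$, $$\left(\sum_{j\in M_{n(t,s)}(i)}\frac{1}{\rho_j(s+t-n(t,s))^{1/(p-1)}}\right)^{p-1}\le M^pe^{pwt}\,\frac{1}{\rho_i(s)}.$$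
   Context: **Directed tree.** A directed tree $G=(V,E)$ consists of a countable vertex set $V$ and a set $E\subset (V\times V)\setminus\{(v,v):v\in V\}$ of directed edges such that: the graph is connected (any two distinct vertices are joined by a finite path, ignoring orientation of edges); there are no closed directed cycles; and each vertex $v$ has at most one parent, i.e. at most one $w\in V$ with $(w,v)\in E$ (then $v$ is a child of $w$). For an edge $e=(v,w)$, $v$ is the tail and $w$ the head. **Directed metric tree.** $L(G)$ is obtained by identifying each edge with $[0,1)$, with coordinate increasing in the direction of the edge. Write $E=\{e_i\}_{i\in I}$ and let $\mathcal{A}=(\mathcal{A}_{ij})_{i,j\in I}$ be given by $\mathcal{A}_{ij}=1$ if the head of $e_i$ is the tail of $e_j$, and $\mathcal{A}_{ij}=0$ otherwise. Put $M_0(i)=\{i\}$ and, for $n\ge 1$, $M_n(i)=\{j\in I:(\mathcal{A}^n)_{ij}\ne 0\}$, i.e. the set of indices $j$ such that $e_j$ is reached from $e_i$ in $n$ steps along the direction of the edges. (Since each column of $\mathcal{A}$ has at most one nonzero entry, $(\mathcal{A}^n)_{ij}\in\{0,1\}$.) Infimum over the empty set is $+\infty$ and sum over the empty set is $0$. **Weights and spaces.** A weight on $L(G)$ is a family $\rho=(\rho_i)_{i\in I}$ of functions $\rho_i:[0,1)\to\mathbb{R}$ with $\rho_i\in L^1((0,1))$ and $\rho_i>0$ a.e. A function $f$ on $L(G)$ is identified with the family $(f_i)_{i\in I}$ of its restrictions to edges, $f_i:[0,1)\to\mathbb{K}$, $\mathbb{K}=\mathbb{R}$ or $\mathbb{C}$.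 For $1\le p<\infty$, $L^p_\rho(L(G))$ is the Banach space of all (a.e. classes of) families $f=(f_i)_{i\in I}$ of measurable functions with $$\|f\|_{p,\rho}=\Big(\sum_{i\in I}\int_0^1|f_i(s)|^p\rho_i(s)\,ds\Big)^{1/p}<\infty.$$ **Left translation.** For $s\in[0,1)$, $t\ge0$, let $n(t,s)$ be the integer part of $s+t$. For $f=(f_i)_{i\in I}$, $t\ge 0$, $$(T_tf)_i(s)=\sum_{j\in M_{n(t,s)}(i)}(\mathcal{A}^{n(t,s)})_{ij}\,f_j\big(t+s-n(t,s)\big)=\sum_{j\in M_{n(t,s)}(i)}f_j\big(t+s-n(t,s)\big),\qquad i\in I,\ s\in[0,1).$$ **Strongly continuous semigroup.** A family $\{T_t\}_{t\ge0}$ of (well-defined) bounded linear operators on a Banach space $X$ with $T_0=I$, $T_{t+s}=T_t\circ T_s$ for all $s,t\ge0$, and $\lim_{s\to t}T_sx=T_tx$ for all $x\in X$, $t\ge0$. *)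

theory Defs
  imports "HOL-Analysis.Analysis"
begin

definition directed_tree :: "'v set \<Rightarrow> ('v \<times> 'v) set \<Rightarrow> bool" where
  "directed_tree V E \<longleftrightarrow>
     countable V \<and>
     E \<subseteq> (V \<times> V) - {(v, v) | v. v \<in> V} \<and>
     (\<forall>u\<in>V. \<forall>v\<in>V. u \<noteq> v \<longrightarrow> (u, v) \<in> (E \<union> E\<inverse>)\<^sup>*) \<and>
     acyclic E \<and>
     (\<forall>u v w. (u, v) \<in> E \<longrightarrow> (w, v) \<in> E \<longrightarrow> u = w)"

text \<open>
  The edges are enumerated by \<open>e\<close> over an index set \<open>I\<close>, possibly infinite. The edge
  \<open>e i = (v, w)\<close> has tail \<open>v\<close> and head \<open>w\<close>. Powers of the infinite adjacency matrix are
  genuine matrix products over \<open>I\<close>; in a directed tree a column has at most one nonzero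
  entry, so each of these sums has at most one nonzero term.
\<close>

definition adj :: "('i \<Rightarrow> 'v \<times> 'v) \<Rightarrow> 'i \<Rightarrow> 'i \<Rightarrow> real" where
  "adj e i j = (if snd (e i) = fst (e j) then 1 else 0)"

primrec adj_pow :: "'i set \<Rightarrow> ('i \<Rightarrow> 'v \<times> 'v) \<Rightarrow> nat \<Rightarrow> 'i \<Rightarrow> 'i \<Rightarrow> real" where
  "adj_pow I e 0 i j = (if i = j then 1 else 0)"
| "adj_pow I e (Suc n) i j = (\<Sum>\<^sub>\<infinity>k\<in>I. adj_pow I e n i k * adj e k j)"

definition reach :: "'i set \<Rightarrow> ('i \<Rightarrow> 'v \<times> 'v) \<Rightarrow> nat \<Rightarrow> 'i \<Rightarrow> 'i set" where
  "reach I e n i = {j \<in> I. adj_pow I e n i j \<noteq> 0}"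

text \<open>
  A function on the metric tree is the family of its restrictions to the edges. Only the
  values at \<open>i \<in> I\<close> and \<open>s \<in> [0,1)\<close> matter.
\<close>

type_synonym ('i, 'k) family = "'i \<Rightarrow> real \<Rightarrow> 'k"

abbreviation unit_measure :: "real measure" where
  "unit_measure \<equiv> lebesgue_on {0..<1}"

definition weight :: "'i set \<Rightarrow> ('i, real) family \<Rightarrow> bool" where
  "weight I \<rho> \<longleftrightarrow>
     (\<forall>i\<in>I. integrable unit_measure (\<rho> i) \<and> (AE s in unit_measure. 0 < \<rho> i s))"

text \<open>Real powers of extended nonnegative numbers, meant for positive exponents.\<close>

definition ennreal_powr :: "ennreal \<Rightarrow> real \<Rightarrow> ennreal" where
  "ennreal_powr x a = (if x = \<infinity> then \<infinity> else ennreal (enn2real x powr a))"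

definition Lp_norm ::
    "real \<Rightarrow> 'i set \<Rightarrow> ('i, real) family \<Rightarrow> ('i, 'k::real_normed_vector) family \<Rightarrow> ennreal" where
  "Lp_norm p I \<rho> f =
     ennreal_powr
       (\<Sum>\<^sub>\<infinity>i\<in>I. \<integral>\<^sup>+ s. ennreal (norm (f i s) powr p * \<rho> i s) \<partial>unit_measure) (1 / p)"

definition Lp_space ::
    "real \<Rightarrow> 'i set \<Rightarrow> ('i, real) family \<Rightarrow> ('i, 'k::real_normed_vector) family set" where
  "Lp_space p I \<rho> =
     {f. (\<forall>i\<in>I. f i \<in> borel_measurable unit_measure) \<and> Lp_norm p I \<rho> f < \<infinity>}"

text \<open>
  The elements of the Banach space are the classes of members of \<^const>\<open>Lp_space\<close> modulo the
  following relation. We work with representatives: operators have to respect the relation,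
  and it replaces equality in every operator identity. The null sets of \<open>\<rho> i(s) ds\<close> are the
  Lebesgue null sets because \<open>\<rho> i > 0\<close> almost everywhere.
\<close>

definition ae_eq :: "'i set \<Rightarrow> ('i, 'k) family \<Rightarrow> ('i, 'k) family \<Rightarrow> bool" where
  "ae_eq I f g \<longleftrightarrow> (\<forall>i\<in>I. AE s in unit_measure. f i s = g i s)"

definition Lp_opnorm ::
    "real \<Rightarrow> 'i set \<Rightarrow> ('i, real) family \<Rightarrow>
     (('i, 'k::real_normed_vector) family \<Rightarrow> ('i, 'k) family) \<Rightarrow> ennreal" where
  "Lp_opnorm p I \<rho> T = (SUP f\<in>{f \<in> Lp_space p I \<rho>. Lp_norm p I \<rho> f \<le> 1}. Lp_norm p I \<rho> (T f))"

definition Lp_bounded_linear ::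
    "real \<Rightarrow> 'i set \<Rightarrow> ('i, real) family \<Rightarrow>
     (('i, 'k::real_normed_field) family \<Rightarrow> ('i, 'k) family) \<Rightarrow> bool" where
  "Lp_bounded_linear p I \<rho> T \<longleftrightarrow>
     (\<forall>f\<in>Lp_space p I \<rho>. T f \<in> Lp_space p I \<rho>) \<and>
     (\<forall>f\<in>Lp_space p I \<rho>. \<forall>g\<in>Lp_space p I \<rho>. ae_eq I f g \<longrightarrow> ae_eq I (T f) (T g)) \<and>
     (\<forall>f\<in>Lp_space p I \<rho>. \<forall>g\<in>Lp_space p I \<rho>.
        ae_eq I (T (\<lambda>i s. f i s + g i s)) (\<lambda>i s. T f i s + T g i s)) \<and>
     (\<forall>c. \<forall>f\<in>Lp_space p I \<rho>. ae_eq I (T (\<lambda>i s. c * f i s)) (\<lambda>i s. c * T f i s)) \<and>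
     Lp_opnorm p I \<rho> T < \<infinity>"

definition strongly_continuous_semigroup ::
    "real \<Rightarrow> 'i set \<Rightarrow> ('i, real) family \<Rightarrow>
     (real \<Rightarrow> ('i, 'k::real_normed_field) family \<Rightarrow> ('i, 'k) family) \<Rightarrow> bool" where
  "strongly_continuous_semigroup p I \<rho> T \<longleftrightarrow>
     (\<forall>t\<ge>0. Lp_bounded_linear p I \<rho> (T t)) \<and>
     (\<forall>f\<in>Lp_space p I \<rho>. ae_eq I (T 0 f) f) \<and>
     (\<forall>t\<ge>0. \<forall>s\<ge>0. \<forall>f\<in>Lp_space p I \<rho>. ae_eq I (T (t + s) f) (T t (T s f))) \<and>
     (\<forall>f\<in>Lp_space p I \<rho>. \<forall>t\<ge>0.
        ((\<lambda>s. Lp_norm p I \<rho> (\<lambda>i x. T s f i x - T t f i x)) \<longlongrightarrow> 0) (at t within {0..}))"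

definition int_part :: "real \<Rightarrow> real \<Rightarrow> nat" where
  "int_part t s = nat \<lfloor>s + t\<rfloor>"

definition left_translation ::
    "'i set \<Rightarrow> ('i \<Rightarrow> 'v \<times> 'v) \<Rightarrow> real \<Rightarrow>
     ('i, 'k::real_normed_vector) family \<Rightarrow> ('i, 'k) family" where
  "left_translation I e t f i s =
     (\<Sum>\<^sub>\<infinity>j\<in>reach I e (int_part t s) i. f j (t + s - real (int_part t s)))"

text \<open>
  A vertex may have infinitely many children, so the sum above can be infinite, and
  \<^const>\<open>infsum\<close> has the value 0 on a divergent family. Convergence for almost every \<open>s\<close> is
  therefore a separate part of the well-definedness of the translations on a space \<open>X\<close>.
\<close>

definition left_translation_defined ::
    "'i set \<Rightarrow> ('i \<Rightarrow> 'v \<times> 'v) \<Rightarrow> ('i, 'k::real_normed_vector) family set \<Rightarrow> bool" where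
  "left_translation_defined I e X \<longleftrightarrow>
     (\<forall>t\<ge>0. \<forall>f\<in>X. \<forall>i\<in>I. AE s in unit_measure.
        (\<lambda>j. f j (t + s - real (int_part t s))) summable_on reach I e (int_part t s) i)"

end

theory Submission
  imports Defs
begin

text \<open>
  Let the modular of \<open>f\<close> be the \<open>p\<close>-th power of its norm, with \<open>p \<ge> 1\<close>, and fix a time \<open>t\<close>. The value
  of the translated family at the point \<open>s\<close> of the edge \<open>i\<close> is the sum of the values of \<open>f\<close> at the point
  \<open>rot t s\<close> (the fractional part of \<open>s + t\<close>) of the edges in the fibre \<open>reach I e (int_part t s) i\<close>.
  Two facts reduce a norm bound to a question about single fibres: the rotation \<open>rot t\<close> preserves
  Lebesgue measure on the unit interval (\<open>distr_rot\<close>), and for fixed \<open>s\<close> the fibres over different edges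
  are disjoint, because each vertex has at most one parent (\<open>reach_source_unique\<close>).

  The question in a fibre is for which \<open>K\<close> the inequality
  \<open>(\<Sum>j. x j) powr p * \<rho> i s \<le> K powr p * (\<Sum>j. x j powr p * \<rho> j (rot t s))\<close>
  holds for all nonnegative finitely supported \<open>x\<close> on the fibre (\<open>fibre_bound\<close>). If it holds in almost every fibre, then
  integrating it over \<open>s\<close> and summing over \<open>i\<close> bounds the norm of the translation by \<open>K\<close>, and the sums
  that define the translation converge almost everywhere (\<open>nn_integral_reach_le\<close>,
  \<open>translation_modular_le\<close>). Conversely, an operator bound \<open>K\<close> is applied to families concentrated above the set
  of points where the inequality fails, which shows that this set is null
  (\<open>opnorm_bound_test_functions\<close>).

  The best constant in the fibre is the norm of a functional on a weighted sequence space. For \<open>p = 1\<close> it is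
  determined by the infimum of the weights. For \<open>p > 1\<close> it is given by Hoelder's inequality, with the extremal vector
  \<open>x j = \<rho> j (rot t s) powr (-1 / (p - 1))\<close>. These are the two conditions of the theorem.

  The semigroup law holds because fibres compose as disjoint unions (\<open>reach_add\<close>, \<open>translation_semigroup\<close>). For strong
  continuity, the bound \<open>M * exp (w * t)\<close> is locally bounded in \<open>t\<close>, so it suffices to treat a dense set of families.
  Those supported on finitely many edges, continuous and zero near the ends of every edge, form such a set,
  and a small translation merely shifts them within each edge
  (\<open>translation_compactly_inside_tendsto\<close>, \<open>translation_continuous\<close>).
\<close>

section \<open>Reachability along directed edges\<close>

text \<open>
  In a directed tree the uniqueness of parents says that an edge is determined by its head.
  So a walk along the edges can be retraced in only one way, although it may branch,
  even infinitely often, in the forward direction.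
\<close>

locale forward_edges =
  fixes I :: "'i set" and e :: "'i \<Rightarrow> 'v \<times> 'v"
  assumes countable_edges: "countable I"
    and inj_head: "inj_on (\<lambda>i. snd (e i)) I"
begin

lemma reach_subset: "reach I e n i \<subseteq> I"
  by (auto simp: reach_def)

lemma countable_reach: "countable (reach I e n i)"
  using countable_edges reach_subset countable_subset by blast

lemma reach_0: "reach I e 0 i = {i} \<inter> I"
  by (auto simp: reach_def)

text \<open>
  Since heads determine edges, a column of the adjacency matrix has at most one nonzero entry.
  The infinite sum in the matrix product therefore consists of a single term.
\<close>

lemma reach_Suc: "reach I e (Suc n) i = {j \<in> I. \<exists>k\<in>reach I e n i. snd (e k) = fst (e j)}"
proof -
  have "adj_pow I e (Suc n) i j \<noteq> 0 \<longleftrightarrow> (\<exists>k\<in>reach I e n i. snd (e k) = fst (e j))" for j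
  proof (cases "\<exists>k\<in>I. snd (e k) = fst (e j)")
    case True
    then obtain k where k: "k \<in> I" "snd (e k) = fst (e j)" by blast
    have uniq: "l = k" if "l \<in> I" "snd (e l) = fst (e j)" for l
      using inj_onD[OF inj_head, of l k] that k by simp
    have "adj_pow I e (Suc n) i j = adj_pow I e n i k * adj e k j"
      using k(1) uniq
      by (subst adj_pow.simps(2), subst infsum_cong_neutral[where T = "{k}" and g = "\<lambda>k. adj_pow I e n i k * adj e k j"])
        (auto simp: adj_def)
    then show ?thesis
      using k by (auto simp: adj_def reach_def dest: uniq)
  next
    case False
    then have "adj_pow I e (Suc n) i j = 0"
      by (auto simp: adj_def intro!: infsum_0)
    then show ?thesis
      using False reach_subset by fastforce
  qed
  then show ?thesis
    by (auto simp: reach_def simp del: adj_pow.simps)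
qed

lemma reach_add: "reach I e (m + n) i = (\<Union>k\<in>reach I e m i. reach I e n k)"
proof (induction n)
  case 0
  then show ?case using reach_subset[of m i] by (auto simp: reach_0)
next
  case (Suc n)
  then show ?case by (auto simp: reach_Suc)
qed

text \<open>
  Walking back \<open>n\<close> steps from \<open>j\<close> is deterministic, so the sets reached in \<open>n\<close> steps from different
  edges are disjoint. Both the norm estimate and the semigroup law rest on this.
\<close>

lemma reach_source_unique:
  assumes "j \<in> reach I e n i" and "j \<in> reach I e n i'"
  shows "i = i'"
  using assms
proof (induction n arbitrary: j)
  case 0
  then show ?case by (auto simp: reach_0)
next
  case (Suc n)
  then obtain k k' where k: "k \<in> reach I e n i" "k' \<in> reach I e n i'" "snd (e k) = snd (e k')"
    by (auto simp: reach_Suc)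
  then have "k = k'"
    using inj_onD[OF inj_head, of k k'] reach_subset by blast
  with k Suc.IH show ?case by blast
qed

end

lemma directed_tree_forward_edges:
  assumes "directed_tree V E" and "bij_betw e I E"
  shows "forward_edges I e"
proof
  have "countable V" and "E \<subseteq> V \<times> V"
    using assms(1) by (auto simp: directed_tree_def)
  then have "countable E"
    by (metis countable_SIGMA countable_subset)
  then show "countable I"
    using assms(2) by (metis bij_betw_def countable_image_inj_on)
  show "inj_on (\<lambda>i. snd (e i)) I"
  proof (rule inj_onI)
    fix k l assume kl: "k \<in> I" "l \<in> I" "snd (e k) = snd (e l)"
    then have "e k \<in> E" "e l \<in> E"
      using assms(2) bij_betwE by blast+
    with kl(3) have "fst (e k) = fst (e l)"
      using assms(1) unfolding directed_tree_def by (metis prod.collapse)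
    with kl have "e k = e l" by (simp add: prod_eq_iff)
    then show "k = l"
      using kl assms(2) by (meson bij_betw_def inj_onD)
  qed
qed

section \<open>Rotation of the unit interval\<close>

text \<open>
  The translation by \<open>t\<close> looks up the value at the point \<open>s\<close> of an edge at the point
  \<open>rot t s\<close> of edges that lie \<open>int_part t s\<close> generations ahead. Defining \<open>rot\<close> for negative
  \<open>t\<close> as well makes the rotations a group, which gives inverses.
\<close>

definition rot :: "real \<Rightarrow> real \<Rightarrow> real" where
  "rot t s = frac (s + t)"

lemma rot_bounds: "0 \<le> rot t s" "rot t s < 1"
  by (simp_all add: rot_def frac_lt_1)

lemma rot_rot: "rot s (rot t x) = rot (t + s) x"
proof -
  have "frac (frac y + s) = frac (y + s)" for y :: real
  proof -
    have "frac y + s = (y + s) - of_int \<lfloor>y\<rfloor>"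
      by (simp add: frac_def)
    then show ?thesis
      by (simp only: frac_def floor_diff_of_int of_int_diff)
  qed
  then show ?thesis
    by (simp add: rot_def add.assoc)
qed

lemma rot_0: "s \<in> {0..<1} \<Longrightarrow> rot 0 s = s"
  by (simp add: rot_def frac_eq)

lemma rot_minus_rot: "s \<in> {0..<1} \<Longrightarrow> rot (- t) (rot t s) = s"
  by (simp add: rot_rot rot_0)

lemma rot_eq:
  assumes "s \<in> {0..<1}" and "t \<ge> 0"
  shows "t + s - real (int_part t s) = rot t s"
  using assms by (simp add: rot_def int_part_def frac_def)

lemma int_part_add:
  assumes "x \<in> {0..<1}" and "t \<ge> 0" and "s \<ge> 0"
  shows "int_part (t + s) x = int_part t x + int_part s (rot t x)"
proof -
  have "\<lfloor>rot t x + s\<rfloor> = \<lfloor>x + t + s\<rfloor> - \<lfloor>x + t\<rfloor>"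
  proof -
    have "rot t x + s = (x + t + s) - of_int \<lfloor>x + t\<rfloor>"
      by (simp add: rot_def frac_def)
    then show ?thesis
      by (simp only: floor_diff_of_int)
  qed
  moreover have "\<lfloor>x + t\<rfloor> \<ge> 0" "\<lfloor>rot t x + s\<rfloor> \<ge> 0"
    using assms rot_bounds(1)[of t x] by auto
  ultimately show ?thesis
    unfolding int_part_def by (simp add: nat_add_distrib[symmetric] add.assoc)
qed

text \<open>
  A rotation exchanges two subintervals and acts as an ordinary translation on each of them.
  This is why it inherits invariance of Lebesgue measure.
\<close>

lemma rot_vimage:
  fixes t :: real
  defines "\<tau> \<equiv> frac t"
  assumes "A \<subseteq> {0..<1}"
  shows "rot t -` A \<inter> {0..<1} = (+) (- \<tau>) ` (A \<inter> {\<tau>..<1}) \<union> (+) (1 - \<tau>) ` (A \<inter> {0..<\<tau>})"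
proof -
  have \<tau>: "0 \<le> \<tau>" "\<tau> < 1" by (simp_all add: \<tau>_def frac_lt_1)
  have rot: "rot t s = (if s + \<tau> < 1 then s + \<tau> else s - (1 - \<tau>))" if "0 \<le> s" "s < 1" for s
    using that by (simp add: rot_def frac_add \<tau>_def frac_eq[THEN iffD2])
  have im: "(+) c ` B = {s. s - c \<in> B}" for c :: real and B
    by force
  show ?thesis
    unfolding im using \<tau> assms(2) by (auto simp: rot split: if_splits)
qed

lemma rot_vimage_measure:
  assumes "A \<in> sets unit_measure"
  shows "rot t -` A \<inter> {0..<1} \<in> sets unit_measure"
    and "emeasure unit_measure (rot t -` A \<inter> {0..<1}) = emeasure unit_measure A"
proof -
  define \<tau> where "\<tau> = frac t"
  have A: "A \<in> sets lebesgue" "A \<subseteq> {0..<1}"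
    using assms by (auto simp: sets_restrict_space)
  let ?B = "A \<inter> {\<tau>..<1}" and ?C = "A \<inter> {0..<\<tau>}"
  have \<tau>: "0 \<le> \<tau>" "\<tau> < 1" by (simp_all add: \<tau>_def frac_lt_1)
  have eq: "rot t -` A \<inter> {0..<1} = (+) (- \<tau>) ` ?B \<union> (+) (1 - \<tau>) ` ?C"
    using rot_vimage[OF A(2)] by (simp add: \<tau>_def)
  have BC: "?B \<in> sets lebesgue" "?C \<in> sets lebesgue"
    using A by auto
  have tr: "(+) c ` S \<in> sets lebesgue" "emeasure lebesgue ((+) c ` S) = emeasure lebesgue S"
    if "S \<in> sets lebesgue" for c :: real and S
  proof -
    have "(\<lambda>x. 1 *\<^sub>R x + c) ` S = (+) c ` S"
      by (simp add: image_def add.commute)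
    then show "emeasure lebesgue ((+) c ` S) = emeasure lebesgue S"
      using emeasure_lebesgue_affine[of 1 c S] by simp
  qed (rule lebesgue_sets_translation[OF that])
  show "rot t -` A \<inter> {0..<1} \<in> sets unit_measure"
  proof -
    have "rot t -` A \<inter> {0..<1} \<in> sets lebesgue"
      unfolding eq by (intro sets.Un tr(1) BC)
    then show ?thesis
      by (auto simp: sets_restrict_space image_iff)
  qed
  have "emeasure lebesgue (rot t -` A \<inter> {0..<1})
      = emeasure lebesgue ((+) (- \<tau>) ` ?B) + emeasure lebesgue ((+) (1 - \<tau>) ` ?C)"
    unfolding eq
  proof (rule plus_emeasure[symmetric])
    show "(+) (- \<tau>) ` ?B \<inter> (+) (1 - \<tau>) ` ?C = {}"
      using \<tau> by auto
  qed (intro tr(1) BC)+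
  also have "\<dots> = emeasure lebesgue ?B + emeasure lebesgue ?C"
    by (simp only: tr(2)[OF BC(1)] tr(2)[OF BC(2)])
  also have "\<dots> = emeasure lebesgue (?B \<union> ?C)"
    by (rule plus_emeasure) (use BC in auto)
  also have "?B \<union> ?C = A"
    using A(2) by force
  finally show "emeasure unit_measure (rot t -` A \<inter> {0..<1}) = emeasure unit_measure A"
    using A(2) by (simp add: emeasure_restrict_space)
qed

lemma rot_measurable [measurable]: "rot t \<in> unit_measure \<rightarrow>\<^sub>M unit_measure"
  by (rule measurableI) (use rot_bounds rot_vimage_measure(1) in auto)

lemma distr_rot: "distr unit_measure unit_measure (rot t) = unit_measure"
  by (rule measure_eqI) (simp_all add: emeasure_distr rot_vimage_measure(2))

lemma AE_rot: "AE s in unit_measure. P s \<Longrightarrow> AE s in unit_measure. P (rot t s)"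
  using AE_distrD[OF rot_measurable[of t], where P = P] unfolding distr_rot by blast

lemma nn_integral_rot:
  assumes "F \<in> borel_measurable unit_measure"
  shows "(\<integral>\<^sup>+s. F (rot t s) \<partial>unit_measure) = (\<integral>\<^sup>+s. F s \<partial>unit_measure)"
  using nn_integral_distr[OF rot_measurable, of F t] assms by (simp add: distr_rot)

lemma borel_measurable_rot:
  assumes "f \<in> borel_measurable unit_measure"
  shows "(\<lambda>s. f (rot t s)) \<in> borel_measurable unit_measure"
  using measurable_compose[OF rot_measurable assms] .

lemma AE_unit_measure_in: "AE s in unit_measure. s \<in> {0..<1}"
  by (rule AE_I2) simp

lemma pred_int_part [measurable]: "Measurable.pred unit_measure (\<lambda>s. P (int_part t s))"
proof -
  have "Measurable.pred borel (\<lambda>s::real. P (int_part t s))"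
    unfolding int_part_def by measurable
  then have "{s. P (int_part t s)} \<in> sets borel"
    by simp
  then have "{s. P (int_part t s)} \<in> sets lebesgue" by simp
  then have "{s\<in>{0..<1}. P (int_part t s)} = {0..<1} \<inter> {s. P (int_part t s)} \<and> {s. P (int_part t s)} \<in> sets lebesgue"
    by auto
  then show ?thesis
    by (auto simp: pred_def sets_restrict_space)
qed

section \<open>Sums and powers of extended nonnegative reals\<close>

lemma infsum_ennreal_eq_SUP:
  fixes f :: "'a \<Rightarrow> ennreal"
  shows "infsum f A = (SUP F\<in>{F. finite F \<and> F \<subseteq> A}. sum f F)"
  by (rule nonneg_infsum_complete) simp

lemma finite_sum_le_infsum_ennreal:
  fixes f :: "'a \<Rightarrow> ennreal"
  assumes "finite F" and "F \<subseteq> A"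
  shows "sum f F \<le> infsum f A"
  unfolding infsum_ennreal_eq_SUP using assms by (intro SUP_upper) auto

text \<open>
  Reading a sum as an integral over the counting measure makes Tonelli's theorem available
  for interchanging sums over edges with integrals along edges.
\<close>

lemma infsum_ennreal_eq_nn_integral:
  fixes f :: "'a \<Rightarrow> ennreal"
  assumes "countable A"
  shows "infsum f A = (\<integral>\<^sup>+x. f x \<partial>count_space A)"
proof (rule antisym)
  have *: "(\<integral>\<^sup>+x. f x * indicator F x \<partial>count_space A) = sum f F" if "finite F" "F \<subseteq> A" for F
    using that by (subst nn_integral_count_space'[of F]) auto
  show "infsum f A \<le> (\<integral>\<^sup>+x. f x \<partial>count_space A)"
    unfolding infsum_ennreal_eq_SUP
  proof (rule SUP_least, clarify)
    fix F assume "finite F" "F \<subseteq> A"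
    then show "sum f F \<le> (\<integral>\<^sup>+x. f x \<partial>count_space A)"
      by (subst *[symmetric]) (auto intro!: nn_integral_mono simp: indicator_def)
  qed
  define B where "B n = {x\<in>A. to_nat_on A x < n}" for n
  have B: "finite (B n)" "B n \<subseteq> A" for n
    using inj_on_finite[of "to_nat_on A" "B n" "{..<n}"] inj_on_to_nat_on[OF assms]
    by (auto simp: B_def inj_on_def)
  have inc: "incseq (\<lambda>n x. f x * indicator (B n) x)"
    by (auto simp: incseq_def le_fun_def B_def indicator_def)
  have "f x = (SUP n. f x * indicator (B n) x)" if "x \<in> A" for x
  proof (rule antisym)
    have "f x = f x * indicator (B (Suc (to_nat_on A x))) x"
      using that by (simp add: B_def)
    also have "\<dots> \<le> (SUP n. f x * indicator (B n) x)"
      by (rule SUP_upper) simp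
    finally show "f x \<le> (SUP n. f x * indicator (B n) x)" .
  qed (auto intro!: SUP_least simp: indicator_def)
  then have "(\<integral>\<^sup>+x. f x \<partial>count_space A) = (\<integral>\<^sup>+x. (SUP n. f x * indicator (B n) x) \<partial>count_space A)"
    by (intro nn_integral_cong) simp
  also have "\<dots> = (SUP n. \<integral>\<^sup>+x. f x * indicator (B n) x \<partial>count_space A)"
    by (rule nn_integral_monotone_convergence_SUP[OF inc]) simp
  also have "\<dots> = (SUP n. sum f (B n))"
    using * B by simp
  also have "\<dots> \<le> infsum f A"
    by (rule SUP_least) (rule finite_sum_le_infsum_ennreal[OF B])
  finally show "(\<integral>\<^sup>+x. f x \<partial>count_space A) \<le> infsum f A" .
qed

lemma ennreal_powr_ennreal: "0 \<le> x \<Longrightarrow> ennreal_powr (ennreal x) a = ennreal (x powr a)"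
  by (simp add: ennreal_powr_def)

lemma ennreal_powr_less_top_iff: "ennreal_powr x a < \<infinity> \<longleftrightarrow> x < \<infinity>"
  by (auto simp: ennreal_powr_def less_top)

lemma ennreal_powr_mono:
  assumes "x \<le> y" and "0 \<le> a"
  shows "ennreal_powr x a \<le> ennreal_powr y a"
proof (cases "y = \<infinity>")
  case False
  then have "x < top" "y < top"
    using assms(1) by (auto simp: less_top le_less_trans)
  then show ?thesis
    using assms by (cases x; cases y) (auto simp: ennreal_powr_ennreal intro!: powr_mono2)
qed (simp add: ennreal_powr_def)

text \<open>
  Through this equivalence all norm bounds become bounds for the \<open>p\<close>-th power of the norm.
\<close>

lemma ennreal_powr_inverse_le_iff:
  assumes "0 \<le> K" and "0 < p"
  shows "ennreal_powr x (1 / p) \<le> ennreal K \<longleftrightarrow> x \<le> ennreal (K powr p)"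
proof (cases x)
  case (real r)
  have "r powr (1 / p) \<le> K \<longleftrightarrow> r \<le> K powr p"
  proof
    assume "r powr (1 / p) \<le> K"
    then have "(r powr (1 / p)) powr p \<le> K powr p"
      using assms by (intro powr_mono2) auto
    then show "r \<le> K powr p" using real assms by (simp add: powr_powr)
  next
    assume "r \<le> K powr p"
    then have "r powr (1 / p) \<le> (K powr p) powr (1 / p)"
      using assms real by (intro powr_mono2) auto
    then show "r powr (1 / p) \<le> K" using assms by (simp add: powr_powr)
  qed
  then show ?thesis
    using real assms by (simp add: ennreal_powr_ennreal)
qed (simp add: ennreal_powr_def top_unique)

section \<open>The weighted inequality in one fibre\<close>

text \<open>
  Hoelder's inequality for finite sums, obtained from Jensen's inequality. With
  \<open>u j = r j powr (-1 / (p - 1))\<close> the sum of the \<open>x j\<close> is the sum of \<open>u j * (x j / u j)\<close>. The power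
  function is convex, so it can be applied to the average of the \<open>x j / u j\<close> with weights
  proportional to \<open>u j\<close>; the choice of \<open>u\<close> makes \<open>u j * (x j / u j) powr p\<close> equal to
  \<open>x j powr p * r j\<close>. Positivity of the \<open>x j\<close> keeps the points inside the domain of convexity.
\<close>

lemma holder_sum_powr_pos:
  fixes x r :: "'a \<Rightarrow> real"
  assumes "finite F" and "F \<noteq> {}" and p: "1 < p"
    and x: "\<And>j. j \<in> F \<Longrightarrow> 0 < x j" and r: "\<And>j. j \<in> F \<Longrightarrow> 0 < r j"
  shows "(\<Sum>j\<in>F. x j) powr p \<le> (\<Sum>j\<in>F. 1 / r j powr (1 / (p - 1))) powr (p - 1) * (\<Sum>j\<in>F. x j powr p * r j)"
proof -
  define u where "u j = 1 / r j powr (1 / (p - 1))" for j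
  define y where "y j = x j / u j" for j
  define U where "U = (\<Sum>j\<in>F. u j)"
  have u: "u j > 0" if "j \<in> F" for j
    using r[OF that] by (simp add: u_def)
  then have U: "U > 0"
    unfolding U_def using assms by (intro sum_pos) auto
  have uy: "u j * y j powr p = x j powr p * r j" if "j \<in> F" for j
  proof -
    have "u j = r j powr (- 1 / (p - 1))"
      using r[OF that] by (simp add: u_def powr_minus_divide)
    then have "u j powr (1 - p) = r j powr (- 1 / (p - 1) * (1 - p))"
      by (simp add: powr_powr)
    also have "- 1 / (p - 1) * (1 - p) = 1"
      using p by (simp add: field_simps)
    finally have "u j powr (1 - p) = r j" using r[OF that] by simp
    moreover have "u j * y j powr p = x j powr p * (u j powr 1 / u j powr p)"
      using u[OF that] x[OF that] by (simp add: y_def powr_divide)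
    ultimately show ?thesis
      by (simp add: powr_diff)
  qed
  have "(\<Sum>j\<in>F. (u j / U) *\<^sub>R y j) powr p \<le> (\<Sum>j\<in>F. (u j / U) * y j powr p)"
    by (rule convex_on_sum[where C = "{0<..}" and f = "\<lambda>z. z powr p"])
      (use assms u U x powr_convex[of p] in \<open>auto simp: y_def U_def sum_divide_distrib[symmetric] less_imp_le\<close>)
  moreover have "(\<Sum>j\<in>F. (u j / U) *\<^sub>R y j) = (\<Sum>j\<in>F. x j) / U"
    unfolding sum_divide_distrib by (rule sum.cong) (use u in \<open>auto simp: y_def less_imp_neq[symmetric] dest!: u\<close>)
  moreover have "(\<Sum>j\<in>F. (u j / U) * y j powr p) = (\<Sum>j\<in>F. x j powr p * r j) / U"
    unfolding sum_divide_distrib by (rule sum.cong) (auto simp: uy[symmetric])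
  ultimately have "((\<Sum>j\<in>F. x j) / U) powr p \<le> (\<Sum>j\<in>F. x j powr p * r j) / U"
    by simp
  then have "(\<Sum>j\<in>F. x j) powr p / U powr p * U powr p \<le> (\<Sum>j\<in>F. x j powr p * r j) / U * U powr p"
    using U x by (intro mult_right_mono) (auto simp: powr_divide sum_nonneg less_imp_le)
  also have "(\<Sum>j\<in>F. x j powr p * r j) / U * U powr p = U powr (p - 1) * (\<Sum>j\<in>F. x j powr p * r j)"
    using U by (simp add: powr_diff)
  finally show ?thesis
    using U by (simp add: U_def u_def)
qed

lemma holder_sum_powr:
  fixes x r :: "'a \<Rightarrow> real"
  assumes F: "finite F" and p: "1 < p"
    and x: "\<And>j. j \<in> F \<Longrightarrow> 0 \<le> x j" and r: "\<And>j. j \<in> F \<Longrightarrow> 0 < r j"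
  shows "(\<Sum>j\<in>F. x j) powr p \<le> (\<Sum>j\<in>F. 1 / r j powr (1 / (p - 1))) powr (p - 1) * (\<Sum>j\<in>F. x j powr p * r j)"
proof (cases "\<forall>j\<in>F. x j = 0")
  case True
  then show ?thesis by simp
next
  case False
  define G where "G = {j\<in>F. x j \<noteq> 0}"
  have G: "finite G" "G \<noteq> {}" "G \<subseteq> F" using F False by (auto simp: G_def)
  have "(\<Sum>j\<in>F. x j) = (\<Sum>j\<in>G. x j)"
    by (rule sum.mono_neutral_right) (use F in \<open>auto simp: G_def\<close>)
  also have "\<dots> powr p \<le> (\<Sum>j\<in>G. 1 / r j powr (1 / (p - 1))) powr (p - 1) * (\<Sum>j\<in>G. x j powr p * r j)"
    by (rule holder_sum_powr_pos[OF G(1,2) p]) (use x r in \<open>auto simp: G_def less_le\<close>)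
  also have "\<dots> \<le> (\<Sum>j\<in>F. 1 / r j powr (1 / (p - 1))) powr (p - 1) * (\<Sum>j\<in>F. x j powr p * r j)"
    using G r p F by (intro mult_mono powr_mono2 sum_mono2 sum_nonneg mult_nonneg_nonneg) (auto simp: less_imp_le subset_iff)
  finally show ?thesis .
qed

text \<open>
  The functional that sums a vector over \<open>J\<close>, from \<open>\<ell>\<^sup>p\<close> over \<open>J\<close> with weights \<open>r\<close> to scalars weighted
  by \<open>a\<close>, has a norm whose \<open>p\<close>-th power is at most \<open>C\<close>. Restricting the test vectors to finitely supported
  nonnegative ones avoids convergence questions; signs and phases only make a sum smaller.
\<close>

definition fibre_bound :: "real \<Rightarrow> real \<Rightarrow> 'i set \<Rightarrow> ('i \<Rightarrow> real) \<Rightarrow> real \<Rightarrow> bool" where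
  "fibre_bound p C J r a \<longleftrightarrow>
     (\<forall>F x. finite F \<longrightarrow> F \<subseteq> J \<longrightarrow> (\<forall>j\<in>F. 0 \<le> x j) \<longrightarrow>
        (\<Sum>j\<in>F. x j) powr p * a \<le> C * (\<Sum>j\<in>F. x j powr p * r j))"

lemma le_cmult_INF_iff:
  fixes r :: "'i \<Rightarrow> real"
  assumes "0 < C"
  shows "ereal a \<le> ereal C * (INF j\<in>J. ereal (r j)) \<longleftrightarrow> (\<forall>j\<in>J. a \<le> C * r j)"
proof
  assume h: "ereal a \<le> ereal C * (INF j\<in>J. ereal (r j))"
  show "\<forall>j\<in>J. a \<le> C * r j"
  proof
    fix j assume "j \<in> J"
    then have "ereal C * (INF j\<in>J. ereal (r j)) \<le> ereal C * ereal (r j)"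
      using assms by (intro ereal_mult_left_mono INF_lower) auto
    from order_trans[OF h this] have "ereal a \<le> ereal (C * r j)" by simp
    then show "a \<le> C * r j" by simp
  qed
next
  assume h: "\<forall>j\<in>J. a \<le> C * r j"
  have "ereal a = ereal C * ereal (a / C)" using assms by simp
  also have "\<dots> \<le> ereal C * (INF j\<in>J. ereal (r j))"
    using assms h by (intro ereal_mult_left_mono INF_greatest) (auto simp: field_simps)
  finally show "ereal a \<le> ereal C * (INF j\<in>J. ereal (r j))" .
qed

text \<open>
  For \<open>p = 1\<close> the sharp constant is the supremum of the \<open>a / r j\<close>.
\<close>

lemma fibre_bound_1:
  assumes "0 \<le> a" and "\<And>j. j \<in> J \<Longrightarrow> a \<le> C * r j" and "\<And>j. j \<in> J \<Longrightarrow> 0 \<le> r j"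
  shows "fibre_bound 1 C J r a"
  unfolding fibre_bound_def
proof (intro allI impI)
  fix F x assume F: "finite F" "F \<subseteq> J" and x: "\<forall>j\<in>F. 0 \<le> (x j :: real)"
  have "(\<Sum>j\<in>F. x j) * a \<le> C * (\<Sum>j\<in>F. x j * r j)"
    unfolding sum_distrib_left sum_distrib_right
  proof (rule sum_mono)
    fix j assume "j \<in> F"
    then have "x j * a \<le> x j * (C * r j)"
      using F x assms by (intro mult_left_mono) auto
    then show "x j * a \<le> C * (x j * r j)" by (simp add: ac_simps)
  qed
  then show "(\<Sum>j\<in>F. x j) powr 1 * a \<le> C * (\<Sum>j\<in>F. x j powr 1 * r j)"
    using x by (simp add: sum_nonneg cong: sum.cong)
qed

text \<open>
  For \<open>p > 1\<close> the norm of summation is governed by the conjugate exponent. Hoelder's inequality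
  gives one direction.
\<close>

lemma fibre_bound_if_dual_sum_le:
  assumes p: "1 < p" and a: "0 < a" and C: "0 \<le> C" and r: "\<And>j. j \<in> J \<Longrightarrow> 0 < r j"
    and le: "ennreal_powr (\<Sum>\<^sub>\<infinity>j\<in>J. ennreal (1 / r j powr (1 / (p - 1)))) (p - 1) \<le> ennreal (C * (1 / a))"
  shows "fibre_bound p C J r a"
  unfolding fibre_bound_def
proof (intro allI impI)
  fix F x assume F: "finite F" "F \<subseteq> J" and x: "\<forall>j\<in>F. 0 \<le> (x j :: real)"
  let ?u = "\<lambda>j. 1 / r j powr (1 / (p - 1))"
  have "ennreal_powr (ennreal (\<Sum>j\<in>F. ?u j)) (p - 1) \<le> ennreal_powr (\<Sum>\<^sub>\<infinity>j\<in>J. ennreal (?u j)) (p - 1)"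
    using F p finite_sum_le_infsum_ennreal[OF F, of "\<lambda>j. ennreal (?u j)"]
    by (intro ennreal_powr_mono) (auto simp: sum_ennreal)
  also note le
  finally have "ennreal ((\<Sum>j\<in>F. ?u j) powr (p - 1)) \<le> ennreal (C * (1 / a))"
    by (simp add: ennreal_powr_ennreal sum_nonneg)
  then have u: "(\<Sum>j\<in>F. ?u j) powr (p - 1) * a \<le> C"
    using a C by (simp add: field_simps)
  have "(\<Sum>j\<in>F. x j) powr p * a \<le> (\<Sum>j\<in>F. ?u j) powr (p - 1) * (\<Sum>j\<in>F. x j powr p * r j) * a"
    using holder_sum_powr[of F p x r] F x r p a by (intro mult_right_mono) auto
  also have "\<dots> = ((\<Sum>j\<in>F. ?u j) powr (p - 1) * a) * (\<Sum>j\<in>F. x j powr p * r j)"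
    by (simp add: ac_simps)
  also have "\<dots> \<le> C * (\<Sum>j\<in>F. x j powr p * r j)"
    using F r by (intro mult_right_mono[OF u] sum_nonneg) (auto simp: less_imp_le subset_iff)
  finally show "(\<Sum>j\<in>F. x j) powr p * a \<le> C * (\<Sum>j\<in>F. x j powr p * r j)" .
qed

text \<open>
  The vector \<open>u\<close> is the equality case of Hoelder's inequality, because it satisfies
  \<open>u j powr p * r j = u j\<close>. Testing the inequality on its finite truncations alone therefore
  recovers the sharp constant, and also the finiteness of the infinite sum.
\<close>

lemma dual_sum_le_if_extremal_bound:
  assumes p: "1 < p" and a: "0 < a" and C: "0 \<le> C" and r: "\<And>j. j \<in> J \<Longrightarrow> 0 < r j"
    and u: "\<And>j. j \<in> J \<Longrightarrow> u j = 1 / r j powr (1 / (p - 1))"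
    and le: "\<And>F. finite F \<Longrightarrow> F \<subseteq> J \<Longrightarrow> (\<Sum>j\<in>F. u j) powr p * a \<le> C * (\<Sum>j\<in>F. u j powr p * r j)"
  shows "ennreal_powr (\<Sum>\<^sub>\<infinity>j\<in>J. ennreal (u j)) (p - 1) \<le> ennreal (C * (1 / a))"
proof -
  have bound: "(\<Sum>j\<in>F. u j) \<le> (C / a) powr (1 / (p - 1))" if F: "finite F" "F \<subseteq> J" for F
  proof (cases "F = {}")
    case False
    let ?S = "\<Sum>j\<in>F. u j"
    have S: "?S > 0"
    proof (rule sum_pos)
      fix j assume "j \<in> F"
      then show "0 < u j" using F r[of j] u[of j] by auto
    qed (use F False in auto)
    have "(\<Sum>j\<in>F. u j powr p * r j) = ?S"
    proof (rule sum.cong)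
      fix j assume "j \<in> F"
      then have j: "0 < r j" "u j = r j powr (- 1 / (p - 1))"
        using F r[of j] u[of j] by (auto simp: powr_minus_divide)
      have "u j powr p * r j = r j powr (- 1 / (p - 1) * p + 1)"
        using j powr_add[of "r j" "- 1 / (p - 1) * p" 1] by (simp add: powr_powr)
      also have "- 1 / (p - 1) * p + 1 = - 1 / (p - 1)"
        using p by (simp add: field_simps)
      finally show "u j powr p * r j = u j" using j by simp
    qed simp
    with le[OF F] have "?S powr p * a \<le> C * ?S" by simp
    moreover have "?S powr p = ?S powr (p - 1) * ?S"
      using S by (simp add: powr_diff)
    ultimately have "?S powr (p - 1) \<le> C / a"
      using S a by (simp add: field_simps)
    then have "(?S powr (p - 1)) powr (1 / (p - 1)) \<le> (C / a) powr (1 / (p - 1))"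
      using p by (intro powr_mono2) auto
    then show ?thesis
      using p S by (simp add: powr_powr)
  qed simp
  have "(\<Sum>\<^sub>\<infinity>j\<in>J. ennreal (u j)) \<le> ennreal ((C / a) powr (1 / (p - 1)))"
    unfolding infsum_ennreal_eq_SUP
  proof (rule SUP_least, clarify)
    fix F assume F: "finite F" "F \<subseteq> J"
    have "(\<Sum>j\<in>F. ennreal (u j)) = ennreal (\<Sum>j\<in>F. u j)"
      using F u by (intro sum_ennreal) (auto simp: subset_iff)
    with bound[OF F] show "(\<Sum>j\<in>F. ennreal (u j)) \<le> ennreal ((C / a) powr (1 / (p - 1)))"
      by (simp add: ennreal_leI)
  qed
  then have "ennreal_powr (\<Sum>\<^sub>\<infinity>j\<in>J. ennreal (u j)) (p - 1)
      \<le> ennreal_powr (ennreal ((C / a) powr (1 / (p - 1)))) (p - 1)"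
    using p by (intro ennreal_powr_mono) auto
  also have "\<dots> = ennreal (C * (1 / a))"
    using p a C by (simp add: ennreal_powr_ennreal powr_powr)
  finally show ?thesis .
qed

text \<open>
  The estimate on finite sums bounds all finite partial sums of norms at once. This yields absolute
  convergence, and then the same estimate for the full sum.
\<close>

lemma fibre_bound_infsum:
  fixes f :: "'i \<Rightarrow> 'k::banach"
  assumes bound: "fibre_bound p C J r a" and p: "0 < p" and C: "0 \<le> C" and a: "0 < a"
    and r: "\<And>j. j \<in> J \<Longrightarrow> 0 < r j"
    and fin: "(\<Sum>\<^sub>\<infinity>j\<in>J. ennreal (norm (f j) powr p * r j)) < \<infinity>"
  shows "(\<lambda>j. norm (f j)) summable_on J"
    and "ennreal (norm (infsum f J) powr p * a) \<le> ennreal C * (\<Sum>\<^sub>\<infinity>j\<in>J. ennreal (norm (f j) powr p * r j))"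
proof -
  obtain S where S: "(\<Sum>\<^sub>\<infinity>j\<in>J. ennreal (norm (f j) powr p * r j)) = ennreal S" "0 \<le> S"
    using fin by (cases "\<Sum>\<^sub>\<infinity>j\<in>J. ennreal (norm (f j) powr p * r j)") auto
  have le: "(\<Sum>j\<in>F. norm (f j)) \<le> (C * S / a) powr (1 / p)" if F: "finite F" "F \<subseteq> J" for F
  proof -
    have "ennreal (\<Sum>j\<in>F. norm (f j) powr p * r j) = (\<Sum>j\<in>F. ennreal (norm (f j) powr p * r j))"
      using F r by (intro sum_ennreal[symmetric]) (auto simp: subset_iff less_imp_le)
    also have "\<dots> \<le> ennreal S"
      using finite_sum_le_infsum_ennreal[OF F, of "\<lambda>j. ennreal (norm (f j) powr p * r j)"] S by simp
    finally have "(\<Sum>j\<in>F. norm (f j) powr p * r j) \<le> S" using S by simp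
    then have "C * (\<Sum>j\<in>F. norm (f j) powr p * r j) \<le> C * S"
      using C by (rule mult_left_mono)
    moreover have "(\<Sum>j\<in>F. norm (f j)) powr p * a \<le> C * (\<Sum>j\<in>F. norm (f j) powr p * r j)"
      using bound F unfolding fibre_bound_def by simp
    ultimately have "(\<Sum>j\<in>F. norm (f j)) powr p \<le> C * S / a"
      using a by (simp add: field_simps)
    then have "((\<Sum>j\<in>F. norm (f j)) powr p) powr (1 / p) \<le> (C * S / a) powr (1 / p)"
      using p by (intro powr_mono2) auto
    then show ?thesis
      using p by (simp add: powr_powr sum_nonneg)
  qed
  show abs: "(\<lambda>j. norm (f j)) summable_on J"
    unfolding abs_summable_iff_bdd_above using le by (intro bdd_aboveI2) auto
  have "norm (infsum f J) \<le> (\<Sum>\<^sub>\<infinity>j\<in>J. norm (f j))"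
    by (rule norm_infsum_bound[OF abs])
  also have "\<dots> \<le> (C * S / a) powr (1 / p)"
    by (rule infsum_le_finite_sums[OF abs]) (use le in auto)
  finally have "norm (infsum f J) powr p \<le> ((C * S / a) powr (1 / p)) powr p"
    using p by (intro powr_mono2) auto
  also have "\<dots> = C * S / a"
    using p C S a by (simp add: powr_powr)
  finally have "norm (infsum f J) powr p * a \<le> C * S"
    using a by (simp add: field_simps)
  then show "ennreal (norm (infsum f J) powr p * a) \<le> ennreal C * (\<Sum>\<^sub>\<infinity>j\<in>J. ennreal (norm (f j) powr p * r j))"
    using C S by (simp add: ennreal_mult[symmetric] ennreal_leI)
qed

section \<open>Measurability of sums over fibres\<close>

text \<open>
  This is the \<open>p\<close>-th power of the weighted norm, written as an iterated integral over
  the edges and along each edge.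
\<close>

definition modular ::
    "real \<Rightarrow> 'i set \<Rightarrow> ('i, real) family \<Rightarrow> ('i, 'k::real_normed_vector) family \<Rightarrow> ennreal" where
  "modular p I \<rho> f =
     (\<integral>\<^sup>+i. \<integral>\<^sup>+s. ennreal (norm (f i s) powr p * \<rho> i s) \<partial>unit_measure \<partial>count_space I)"

lemma nn_integral_count_space_subset:
  assumes "A \<subseteq> I"
  shows "(\<integral>\<^sup>+j. g j \<partial>count_space A) = (\<integral>\<^sup>+j. g j * indicator A j \<partial>count_space I)"
proof -
  have "(\<integral>\<^sup>+j. g j \<partial>count_space A) = (\<integral>\<^sup>+j. g j * indicator A j \<partial>count_space UNIV)"
    by (rule nn_integral_count_space_indicator) auto
  also have "\<dots> = (\<integral>\<^sup>+j. g j * indicator A j * indicator I j \<partial>count_space UNIV)"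
    using assms by (intro nn_integral_cong) (auto simp: indicator_def)
  also have "\<dots> = (\<integral>\<^sup>+j. g j * indicator A j \<partial>count_space I)"
    by (rule nn_integral_count_space_indicator[symmetric]) auto
  finally show ?thesis .
qed

text \<open>
  Lebesgue measure is complete, so functions may be changed on null sets.
\<close>

lemma borel_measurable_unit_AE_cong:
  fixes f g :: "real \<Rightarrow> 'k::euclidean_space"
  assumes f: "f \<in> borel_measurable unit_measure" and ae: "AE s in unit_measure. f s = g s"
  shows "g \<in> borel_measurable unit_measure"
proof -
  have "AE s in lebesgue. (if s \<in> {0..<1} then f s else 0) = (if s \<in> {0..<1} then g s else 0)"
    using ae by (subst (asm) AE_restrict_space_iff) (auto elim: eventually_mono)
  then have "(\<lambda>s. if s \<in> {0..<1} then g s else 0) \<in> borel_measurable lebesgue"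
    using f borel_measurable_if[of "{0..<1::real}" f] borel_measurable_AE by fastforce
  then show ?thesis
    using borel_measurable_if[of "{0..<1::real}" g] by simp
qed

lemma borel_measurable_nn_integral_count_space:
  fixes G :: "'i \<Rightarrow> 'a \<Rightarrow> ennreal"
  assumes I: "countable I" and G: "\<And>j. j \<in> I \<Longrightarrow> G j \<in> borel_measurable M"
  shows "(\<lambda>s. \<integral>\<^sup>+j. G j s \<partial>count_space I) \<in> borel_measurable M"
proof -
  define N where "N = to_nat_on I ` I"
  have bij: "bij_betw (from_nat_into I) N I"
    using I by (auto simp: bij_betw_def inj_on_def N_def image_image)
  have "(\<integral>\<^sup>+j. G j s \<partial>count_space I) = (\<Sum>n. G (from_nat_into I n) s * indicator N n)" for s
    by (subst nn_integral_bij_count_space[OF bij, symmetric])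
      (simp add: nn_integral_count_space_subset[of N UNIV] nn_integral_count_space_nat)
  moreover have "(\<lambda>s. G (from_nat_into I n) s * indicator N n) \<in> borel_measurable M" for n
  proof (cases "n \<in> N")
    case True
    then have [measurable]: "G (from_nat_into I n) \<in> borel_measurable M"
      using bij by (intro G) (auto simp: bij_betw_def)
    show ?thesis by measurable
  qed simp
  ultimately show ?thesis
    by (simp add: borel_measurable_suminf_order)
qed

text \<open>
  An enumeration of \<open>I\<close> turns the sum into a series of measurable functions. The two agree wherever the sum
  converges, hence almost everywhere, which is enough by completeness.
\<close>

lemma borel_measurable_infsum_unit:
  fixes a :: "'i \<Rightarrow> real \<Rightarrow> 'k::euclidean_space"
  assumes I: "countable I" "\<And>s. J s \<subseteq> I"
    and a: "\<And>j. j \<in> I \<Longrightarrow> a j \<in> borel_measurable unit_measure"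
    and J: "\<And>j. j \<in> I \<Longrightarrow> Measurable.pred unit_measure (\<lambda>s. j \<in> J s)"
    and sum: "AE s in unit_measure. (\<lambda>j. a j s) summable_on J s"
  shows "(\<lambda>s. \<Sum>\<^sub>\<infinity>j\<in>J s. a j s) \<in> borel_measurable unit_measure"
proof (rule borel_measurable_unit_AE_cong)
  define N where "N = to_nat_on I ` I"
  define h where "h s n = (if n \<in> N \<and> from_nat_into I n \<in> J s then a (from_nat_into I n) s else 0)" for s n
  have bij: "bij_betw (from_nat_into I) N I"
    using I(1) by (auto simp: bij_betw_def inj_on_def N_def image_image)
  have "(\<lambda>s. h s n) \<in> borel_measurable unit_measure" for n
  proof (cases "n \<in> N")
    case True
    then have k: "from_nat_into I n \<in> I" using bij by (auto simp: bij_betw_def)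
    note [measurable] = a[OF k] J[OF k]
    show ?thesis unfolding h_def using True by simp
  qed (simp add: h_def)
  then show "(\<lambda>s. suminf (h s)) \<in> borel_measurable unit_measure"
    by (rule borel_measurable_suminf)
  show "AE s in unit_measure. suminf (h s) = (\<Sum>\<^sub>\<infinity>j\<in>J s. a j s)"
    using sum
  proof eventually_elim
    case (elim s)
    let ?b = "\<lambda>j. if j \<in> J s then a j s else 0"
    have "((\<lambda>j. a j s) has_sum (\<Sum>\<^sub>\<infinity>j\<in>J s. a j s)) (J s)"
      using elim by (rule has_sum_infsum)
    then have "(?b has_sum (\<Sum>\<^sub>\<infinity>j\<in>J s. a j s)) I"
      using I(2)[of s] by (subst (asm) has_sum_cong_neutral[where T = I and g = ?b]) auto
    then have "((\<lambda>n. ?b (from_nat_into I n)) has_sum (\<Sum>\<^sub>\<infinity>j\<in>J s. a j s)) N"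
      by (subst has_sum_reindex_bij_betw[OF bij])
    then have "(h s has_sum (\<Sum>\<^sub>\<infinity>j\<in>J s. a j s)) UNIV"
      by (subst (asm) has_sum_cong_neutral[where T = UNIV and g = "h s"]) (auto simp: h_def)
    then show ?case
      using has_sum_imp_sums sums_unique by metis
  qed
qed

section \<open>Integrating over the fibres of the translation\<close>

context forward_edges
begin

lemma left_translation_eq:
  assumes "s \<in> {0..<1}" and "0 \<le> t"
  shows "left_translation I e t f i s = (\<Sum>\<^sub>\<infinity>j\<in>reach I e (int_part t s) i. f j (rot t s))"
  using assms by (simp add: left_translation_def rot_eq)

text \<open>
  The function \<open>s \<mapsto> \<Sum>j. G j s\<close> has a finite integral, so it is finite almost everywhere, and this
  survives the measure preserving rotation.
\<close>

lemma AE_nn_integral_rot_finite: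
  assumes "\<And>j. j \<in> I \<Longrightarrow> G j \<in> borel_measurable unit_measure"
    and "(\<integral>\<^sup>+j. \<integral>\<^sup>+s. G j s \<partial>unit_measure \<partial>count_space I) < \<infinity>"
  shows "AE s in unit_measure. (\<integral>\<^sup>+j. G j (rot t s) \<partial>count_space I) < \<infinity>"
proof -
  have [measurable]: "(\<lambda>s. \<integral>\<^sup>+j. G j s \<partial>count_space I) \<in> borel_measurable unit_measure"
    using countable_edges assms(1) by (intro borel_measurable_nn_integral_count_space) auto
  have "(\<integral>\<^sup>+s. \<integral>\<^sup>+j. G j s \<partial>count_space I \<partial>unit_measure) \<noteq> \<infinity>"
    using assms nn_integral_count_space_nn_integral[OF countable_edges, of G unit_measure] by simp
  then have "AE s in unit_measure. (\<integral>\<^sup>+j. G j s \<partial>count_space I) \<noteq> \<infinity>"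
    by (intro nn_integral_PInf_AE) simp_all
  then have "AE s in unit_measure. (\<integral>\<^sup>+j. G j s \<partial>count_space I) < \<infinity>"
    by (simp add: less_top)
  then show ?thesis by (rule AE_rot)
qed

text \<open>
  For fixed \<open>s\<close> the fibres over distinct edges are disjoint, so summing over all of them counts every
  edge at most once. The remaining integral over \<open>s\<close> is invariant under the rotation. This is the estimate
  by which a pointwise inequality in the fibres becomes a bound for the operator.
\<close>

lemma nn_integral_reach_le:
  assumes G: "\<And>j. j \<in> I \<Longrightarrow> G j \<in> borel_measurable unit_measure"
  shows "(\<integral>\<^sup>+i. \<integral>\<^sup>+s. \<integral>\<^sup>+j. G j (rot t s) \<partial>count_space (reach I e (int_part t s) i) \<partial>unit_measure \<partial>count_space I)
    \<le> (\<integral>\<^sup>+j. \<integral>\<^sup>+s. G j s \<partial>unit_measure \<partial>count_space I)"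
proof -
  let ?ind = "\<lambda>i s j. indicator (reach I e (int_part t s) i) j :: ennreal"
  have Gr: "(\<lambda>s. G j (rot t s)) \<in> borel_measurable unit_measure" if "j \<in> I" for j
    using measurable_compose[OF rot_measurable G[OF that]] .
  have Gri: "(\<lambda>s. G j (rot t s) * ?ind i s j) \<in> borel_measurable unit_measure" if "j \<in> I" for i j
  proof -
    note [measurable] = Gr[OF that]
    have "(\<lambda>s. G j (rot t s) * ?ind i s j)
        = (\<lambda>s. if j \<in> reach I e (int_part t s) i then G j (rot t s) else 0)"
      by (auto simp: indicator_def)
    then show ?thesis by simp
  qed
  \<comment> \<open>An edge \<open>j\<close> lies in the fibre of at most one edge \<open>i\<close>.\<close>
  have one: "(\<integral>\<^sup>+i. ?ind i s j \<partial>count_space I) \<le> 1" for s j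
  proof (cases "\<exists>k\<in>I. j \<in> reach I e (int_part t s) k")
    case True
    then obtain k where k: "k \<in> I" "j \<in> reach I e (int_part t s) k" by blast
    have "?ind i s j = indicator {k} i" for i
      using k reach_source_unique by (auto simp: indicator_def)
    then show ?thesis using k by (simp add: one_ennreal_def)
  next
    case False
    then have "(\<integral>\<^sup>+i. ?ind i s j \<partial>count_space I) = (\<integral>\<^sup>+i. 0 \<partial>count_space I)"
      by (intro nn_integral_cong) (auto simp: indicator_def)
    then show ?thesis by simp
  qed
  have "(\<integral>\<^sup>+i. \<integral>\<^sup>+s. \<integral>\<^sup>+j. G j (rot t s) \<partial>count_space (reach I e (int_part t s) i) \<partial>unit_measure \<partial>count_space I)
      = (\<integral>\<^sup>+i. \<integral>\<^sup>+s. \<integral>\<^sup>+j. G j (rot t s) * ?ind i s j \<partial>count_space I \<partial>unit_measure \<partial>count_space I)"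
    by (simp add: nn_integral_count_space_subset[OF reach_subset])
  also have "\<dots> = (\<integral>\<^sup>+s. \<integral>\<^sup>+i. \<integral>\<^sup>+j. G j (rot t s) * ?ind i s j \<partial>count_space I \<partial>count_space I \<partial>unit_measure)"
    using countable_edges Gri
    by (intro nn_integral_count_space_nn_integral[symmetric] borel_measurable_nn_integral_count_space) auto
  also have "\<dots> = (\<integral>\<^sup>+s. \<integral>\<^sup>+j. \<integral>\<^sup>+i. G j (rot t s) * ?ind i s j \<partial>count_space I \<partial>count_space I \<partial>unit_measure)"
    using countable_edges
    by (intro nn_integral_cong nn_integral_count_space_nn_integral) auto
  also have "\<dots> = (\<integral>\<^sup>+s. \<integral>\<^sup>+j. G j (rot t s) * (\<integral>\<^sup>+i. ?ind i s j \<partial>count_space I) \<partial>count_space I \<partial>unit_measure)"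
    by (simp add: nn_integral_cmult)
  also have "\<dots> \<le> (\<integral>\<^sup>+s. \<integral>\<^sup>+j. G j (rot t s) * 1 \<partial>count_space I \<partial>unit_measure)"
    by (intro nn_integral_mono mult_left_mono one) simp
  also have "\<dots> = (\<integral>\<^sup>+j. \<integral>\<^sup>+s. G j (rot t s) \<partial>unit_measure \<partial>count_space I)"
    using countable_edges Gr by (simp add: nn_integral_count_space_nn_integral)
  also have "\<dots> = (\<integral>\<^sup>+j. \<integral>\<^sup>+s. G j s \<partial>unit_measure \<partial>count_space I)"
    using G by (intro nn_integral_cong nn_integral_rot) auto
  finally show ?thesis .
qed

end

section \<open>The weighted norm\<close>

locale weighted_edges = forward_edges I e
  for I :: "'i set" and e :: "'i \<Rightarrow> 'v \<times> 'v" +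
  fixes \<rho> :: "('i, real) family" and p :: real
  assumes weight: "weight I \<rho>" and p_ge_1: "1 \<le> p"
begin

lemma weight_integrable: "i \<in> I \<Longrightarrow> integrable unit_measure (\<rho> i)"
  using weight by (simp add: weight_def)

lemma weight_measurable: "i \<in> I \<Longrightarrow> \<rho> i \<in> borel_measurable unit_measure"
  using weight_integrable by (rule borel_measurable_integrable)

lemma AE_weight_pos: "AE s in unit_measure. \<forall>i\<in>I. 0 < \<rho> i s"
  using weight countable_edges by (simp add: AE_ball_countable weight_def)

lemma AE_weight_rot_pos: "AE s in unit_measure. \<forall>i\<in>I. 0 < \<rho> i (rot t s)"
  by (rule AE_rot[OF AE_weight_pos])

lemma integrand_measurable:
  assumes "i \<in> I" and "f i \<in> borel_measurable unit_measure"
  shows "(\<lambda>s. ennreal (norm (f i s) powr p * \<rho> i s)) \<in> borel_measurable unit_measure"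
proof -
  note [measurable] = assms(2) weight_measurable[OF assms(1)]
  show ?thesis by measurable
qed

lemma Lp_norm_eq: "Lp_norm p I \<rho> f = ennreal_powr (modular p I \<rho> f) (1 / p)"
  unfolding Lp_norm_def modular_def
  by (subst infsum_ennreal_eq_nn_integral[OF countable_edges]) simp

lemma Lp_norm_le_iff:
  "0 \<le> K \<Longrightarrow> Lp_norm p I \<rho> f \<le> ennreal K \<longleftrightarrow> modular p I \<rho> f \<le> ennreal (K powr p)"
  using p_ge_1 by (simp add: Lp_norm_eq ennreal_powr_inverse_le_iff)

lemma Lp_space_iff:
  "f \<in> Lp_space p I \<rho> \<longleftrightarrow>
     (\<forall>i\<in>I. f i \<in> borel_measurable unit_measure) \<and> modular p I \<rho> f < \<infinity>"
  by (simp add: Lp_space_def Lp_norm_eq ennreal_powr_less_top_iff del: infinity_ennreal_def)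

lemma modular_cong:
  assumes "ae_eq I f g"
  shows "modular p I \<rho> f = modular p I \<rho> g"
  unfolding modular_def
proof (rule nn_integral_cong, rule nn_integral_cong_AE)
  fix i assume "i \<in> space (count_space I)"
  then have "AE s in unit_measure. f i s = g i s"
    using assms by (simp add: ae_eq_def)
  then show "AE s in unit_measure. ennreal (norm (f i s) powr p * \<rho> i s) = ennreal (norm (g i s) powr p * \<rho> i s)"
    by eventually_elim simp
qed

lemma modular_scale:
  fixes c :: "'k::real_normed_field"
  assumes "\<And>i. i \<in> I \<Longrightarrow> f i \<in> borel_measurable unit_measure"
  shows "modular p I \<rho> (\<lambda>i s. c * f i s) = ennreal (norm c powr p) * modular p I \<rho> f"
proof -
  have "ennreal (norm (c * f i s) powr p * \<rho> i s)
      = ennreal (norm c powr p) * ennreal (norm (f i s) powr p * \<rho> i s)" for i s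
    by (simp add: norm_mult powr_mult ennreal_mult' mult.assoc)
  then have "modular p I \<rho> (\<lambda>i s. c * f i s) = (\<integral>\<^sup>+i. ennreal (norm c powr p) *
      (\<integral>\<^sup>+s. ennreal (norm (f i s) powr p * \<rho> i s) \<partial>unit_measure) \<partial>count_space I)"
    unfolding modular_def
    by (intro nn_integral_cong) (simp add: nn_integral_cmult integrand_measurable assms)
  then show ?thesis
    by (simp add: nn_integral_cmult modular_def)
qed

lemma modular_minus_commute:
  "modular p I \<rho> (\<lambda>i s. f i s - g i s) = modular p I \<rho> (\<lambda>i s. g i s - f i s)"
  unfolding modular_def by (simp add: norm_minus_commute)

text \<open>
  A triangle inequality up to a constant factor suffices for all the limit arguments below and
  needs no more than monotonicity of powers.
\<close>

lemma norm_add_powr_le: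
  fixes x y :: "'k::real_normed_vector"
  shows "norm (x + y) powr p \<le> 2 powr p * (norm x powr p + norm y powr p)"
proof -
  have "norm (x + y) powr p \<le> (2 * max (norm x) (norm y)) powr p"
    using p_ge_1 norm_triangle_ineq[of x y] by (intro powr_mono2) auto
  also have "\<dots> = 2 powr p * max (norm x) (norm y) powr p"
    by (simp add: powr_mult)
  also have "max (norm x) (norm y) powr p \<le> norm x powr p + norm y powr p"
    by (simp add: max_def)
  finally show ?thesis by simp
qed

lemma modular_add_le:
  assumes f: "\<And>i. i \<in> I \<Longrightarrow> f i \<in> borel_measurable unit_measure"
    and g: "\<And>i. i \<in> I \<Longrightarrow> g i \<in> borel_measurable unit_measure"
  shows "modular p I \<rho> (\<lambda>i s. f i s + g i s)
    \<le> ennreal (2 powr p) * (modular p I \<rho> f + modular p I \<rho> g)"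
proof -
  have le: "ennreal (norm (f i s + g i s) powr p * \<rho> i s)
      \<le> ennreal (2 powr p) * (ennreal (norm (f i s) powr p * \<rho> i s) + ennreal (norm (g i s) powr p * \<rho> i s))" for i s
  proof -
    have "ennreal (norm (f i s + g i s) powr p * \<rho> i s) = ennreal (norm (f i s + g i s) powr p) * ennreal (\<rho> i s)"
      by (simp add: ennreal_mult')
    also have "\<dots> \<le> ennreal (2 powr p * (norm (f i s) powr p + norm (g i s) powr p)) * ennreal (\<rho> i s)"
      by (intro mult_right_mono ennreal_leI norm_add_powr_le) simp
    finally show ?thesis
      by (simp add: ennreal_mult' distrib_left distrib_right mult.assoc)
  qed
  have "modular p I \<rho> (\<lambda>i s. f i s + g i s) \<le> (\<integral>\<^sup>+i. \<integral>\<^sup>+s. ennreal (2 powr p) *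
      (ennreal (norm (f i s) powr p * \<rho> i s) + ennreal (norm (g i s) powr p * \<rho> i s)) \<partial>unit_measure \<partial>count_space I)"
    unfolding modular_def by (intro nn_integral_mono le)
  also have "\<dots> = (\<integral>\<^sup>+i. ennreal (2 powr p) * ((\<integral>\<^sup>+s. ennreal (norm (f i s) powr p * \<rho> i s) \<partial>unit_measure)
      + (\<integral>\<^sup>+s. ennreal (norm (g i s) powr p * \<rho> i s) \<partial>unit_measure)) \<partial>count_space I)"
  proof (rule nn_integral_cong)
    fix i assume "i \<in> space (count_space I)"
    then have i: "i \<in> I" by simp
    note [measurable] = integrand_measurable[where f = f, OF i f[OF i]] integrand_measurable[where f = g, OF i g[OF i]]
    show "(\<integral>\<^sup>+s. ennreal (2 powr p) * (ennreal (norm (f i s) powr p * \<rho> i s)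
          + ennreal (norm (g i s) powr p * \<rho> i s)) \<partial>unit_measure)
        = ennreal (2 powr p) * ((\<integral>\<^sup>+s. ennreal (norm (f i s) powr p * \<rho> i s) \<partial>unit_measure)
          + (\<integral>\<^sup>+s. ennreal (norm (g i s) powr p * \<rho> i s) \<partial>unit_measure))"
      by (simp add: nn_integral_cmult nn_integral_add)
  qed
  finally show ?thesis
    by (simp add: modular_def nn_integral_cmult nn_integral_add)
qed

text \<open>
  The operator norm is a supremum over the unit ball, so \<open>f\<close> is scaled into it. Dividing by a
  number slightly larger than the norm of \<open>f\<close> and letting this number decrease also covers
  families of norm zero.
\<close>

lemma modular_le_of_opnorm_le:
  fixes T :: "('i, 'k::{real_normed_field, euclidean_space}) family \<Rightarrow> ('i, 'k) family"
  assumes K: "Lp_opnorm p I \<rho> T \<le> ennreal K" "0 \<le> K"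
    and f: "f \<in> Lp_space p I \<rho>" and Tf: "\<And>i. i \<in> I \<Longrightarrow> T f i \<in> borel_measurable unit_measure"
    and hom: "\<And>c. T (\<lambda>i s. c * f i s) = (\<lambda>i s. c * T f i s)"
  shows "modular p I \<rho> (T f) \<le> ennreal (K powr p) * modular p I \<rho> f"
proof -
  obtain m where m: "modular p I \<rho> f = ennreal m" "0 \<le> m"
    using f by (cases "modular p I \<rho> f") (auto simp: Lp_space_iff)
  have fm: "f i \<in> borel_measurable unit_measure" if "i \<in> I" for i
    using f that by (simp add: Lp_space_iff)
  have le: "modular p I \<rho> (T f) \<le> ennreal (K powr p * b)" if b: "m < b" for b
  proof -
    have b0: "0 < b" using m b by simp
    define c where "c = (1 / b) powr (1 / p)"
    have c: "c powr p = 1 / b" "0 \<le> c"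
      using p_ge_1 b0 by (simp_all add: c_def powr_powr)
    let ?cf = "\<lambda>i s. of_real c * f i s"
    have mcf: "modular p I \<rho> ?cf = ennreal (1 / b * m)"
      using fm c m b0 ennreal_mult[of "1 / b" m] by (simp add: modular_scale)
    also have "\<dots> \<le> 1"
      using b b0 by (simp add: field_simps)
    finally have n: "modular p I \<rho> ?cf \<le> ennreal (1 powr p)" by simp
    have "?cf \<in> Lp_space p I \<rho>"
      unfolding Lp_space_iff mcf
    proof (intro conjI ballI)
      fix i assume "i \<in> I"
      note [measurable] = fm[OF this]
      show "?cf i \<in> borel_measurable unit_measure" by measurable
    qed simp
    moreover have "Lp_norm p I \<rho> ?cf \<le> 1"
      using n Lp_norm_le_iff[of 1 ?cf] by simp
    ultimately have "Lp_norm p I \<rho> (T ?cf) \<le> Lp_opnorm p I \<rho> T"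
      unfolding Lp_opnorm_def by (intro SUP_upper) auto
    with K have "modular p I \<rho> (T ?cf) \<le> ennreal (K powr p)"
      using Lp_norm_le_iff[of K "T ?cf"] by (metis order_trans)
    then have "ennreal (1 / b) * modular p I \<rho> (T f) \<le> ennreal (K powr p)"
      using c Tf by (simp add: hom modular_scale)
    then have "ennreal b * (ennreal (1 / b) * modular p I \<rho> (T f)) \<le> ennreal b * ennreal (K powr p)"
      by (rule mult_left_mono) simp
    then show ?thesis
      using b0 by (simp add: mult.assoc[symmetric] ennreal_mult[symmetric] mult.commute)
  qed
  have "modular p I \<rho> (T f) \<le> ennreal (K powr p * m)"
  proof (rule ennreal_le_epsilon)
    fix \<epsilon> :: real assume "0 < \<epsilon>"
    define b where "b = m + \<epsilon> / (K powr p + 1)"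
    have pos: "0 < K powr p + 1"
      by (simp add: add_nonneg_pos)
    have "K powr p * (\<epsilon> / (K powr p + 1)) \<le> \<epsilon>"
      using pos \<open>0 < \<epsilon>\<close> by (simp add: field_simps)
    then have "K powr p * b \<le> K powr p * m + \<epsilon>"
      by (simp add: b_def distrib_left)
    moreover have "m < b" using pos \<open>0 < \<epsilon>\<close> by (simp add: b_def)
    ultimately have "modular p I \<rho> (T f) \<le> ennreal (K powr p * m + \<epsilon>)"
      using le[of b] by (meson ennreal_leI order_trans)
    then show "modular p I \<rho> (T f) \<le> ennreal (K powr p * m) + ennreal \<epsilon>"
      using m \<open>0 < \<epsilon>\<close> by (simp add: ennreal_plus)
  qed
  then show ?thesis
    using m by (simp add: ennreal_mult)
qed

section \<open>Boundedness of the translations\<close>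

text \<open>
  The inequality in the fibre over almost every point. It is the common reformulation of the operator bound
  \<open>C powr (1 / p)\<close> and of the two explicit conditions on the weight.
\<close>

abbreviation pointwise_bound :: "real \<Rightarrow> real \<Rightarrow> bool" where
  "pointwise_bound C t \<equiv> \<forall>i\<in>I. AE s in unit_measure.
     fibre_bound p C (reach I e (int_part t s) i) (\<lambda>j. \<rho> j (rot t s)) (\<rho> i s)"

text \<open>
  Finiteness of the norm of \<open>f\<close> makes the weighted \<open>p\<close>-th powers summable over almost every fibre;
  there the inequality in the fibre applies.
\<close>

lemma translation_fibrewise:
  fixes f :: "('i, 'k::{real_normed_field, euclidean_space}) family"
  assumes f: "f \<in> Lp_space p I \<rho>" and C: "0 \<le> C" and bound: "pointwise_bound C t" and i: "i \<in> I"
  shows "AE s in unit_measure.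
      (\<lambda>j. norm (f j (rot t s))) summable_on reach I e (int_part t s) i \<and>
      ennreal (norm (\<Sum>\<^sub>\<infinity>j\<in>reach I e (int_part t s) i. f j (rot t s)) powr p * \<rho> i s)
        \<le> ennreal C * (\<integral>\<^sup>+j. ennreal (norm (f j (rot t s)) powr p * \<rho> j (rot t s))
             \<partial>count_space (reach I e (int_part t s) i))"
proof -
  let ?G = "\<lambda>j s. ennreal (norm (f j s) powr p * \<rho> j s)"
  have "AE s in unit_measure. (\<integral>\<^sup>+j. ?G j (rot t s) \<partial>count_space I) < \<infinity>"
    using f by (intro AE_nn_integral_rot_finite integrand_measurable) (auto simp: Lp_space_iff modular_def)
  moreover have "AE s in unit_measure. fibre_bound p C (reach I e (int_part t s) i) (\<lambda>j. \<rho> j (rot t s)) (\<rho> i s)"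
    using bound i by blast
  ultimately show ?thesis
    using AE_weight_pos AE_weight_rot_pos[of t]
  proof eventually_elim
    case (elim s)
    let ?J = "reach I e (int_part t s) i"
    have eq: "(\<Sum>\<^sub>\<infinity>j\<in>?J. ?G j (rot t s)) = (\<integral>\<^sup>+j. ?G j (rot t s) \<partial>count_space ?J)"
      by (rule infsum_ennreal_eq_nn_integral[OF countable_reach])
    have "\<dots> \<le> (\<integral>\<^sup>+j. ?G j (rot t s) \<partial>count_space I)"
      unfolding nn_integral_count_space_subset[OF reach_subset]
      by (intro nn_integral_mono) (auto simp: indicator_def)
    with elim(1) eq have "(\<Sum>\<^sub>\<infinity>j\<in>?J. ?G j (rot t s)) < \<infinity>"
      by (simp add: le_less_trans)
    then show ?case
      using fibre_bound_infsum[OF elim(2) _ C, of "\<lambda>j. f j (rot t s)"] elim(3,4) i reach_subset p_ge_1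
      unfolding eq by (meson less_le_trans subsetD zero_less_one)
  qed
qed

lemma translation_summable:
  fixes f :: "('i, 'k::{real_normed_field, euclidean_space}) family"
  assumes f: "f \<in> Lp_space p I \<rho>" and C: "0 \<le> C" and bound: "pointwise_bound C t" and i: "i \<in> I"
  shows "AE s in unit_measure. (\<lambda>j. f j (rot t s)) summable_on reach I e (int_part t s) i"
  using translation_fibrewise[OF assms] by eventually_elim (blast intro: abs_summable_summable)

lemma translation_measurable:
  fixes f :: "('i, 'k::{real_normed_field, euclidean_space}) family"
  assumes f: "f \<in> Lp_space p I \<rho>" and t: "0 \<le> t" and C: "0 \<le> C" and bound: "pointwise_bound C t" and i: "i \<in> I"
  shows "left_translation I e t f i \<in> borel_measurable unit_measure"
proof -
  have "(\<lambda>s. \<Sum>\<^sub>\<infinity>j\<in>reach I e (int_part t s) i. f j (rot t s)) \<in> borel_measurable unit_measure"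
    using f by (intro borel_measurable_infsum_unit[OF countable_edges reach_subset]
        borel_measurable_rot translation_summable[OF f C bound i]) (auto simp: Lp_space_iff)
  then show ?thesis
    by (subst measurable_cong) (auto simp: left_translation_eq[OF _ t])
qed

lemma translation_modular_le:
  fixes f :: "('i, 'k::{real_normed_field, euclidean_space}) family"
  assumes f: "f \<in> Lp_space p I \<rho>" and t: "0 \<le> t" and C: "0 \<le> C" and bound: "pointwise_bound C t"
  shows "modular p I \<rho> (left_translation I e t f) \<le> ennreal C * modular p I \<rho> f"
proof -
  let ?G = "\<lambda>j s. ennreal (norm (f j s) powr p * \<rho> j s)"
  let ?H = "\<lambda>i s. \<integral>\<^sup>+j. ?G j (rot t s) \<partial>count_space (reach I e (int_part t s) i)"
  have G: "?G j \<in> borel_measurable unit_measure" if "j \<in> I" for j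
    using f that by (intro integrand_measurable) (auto simp: Lp_space_iff)
  have H: "?H i \<in> borel_measurable unit_measure" for i
    unfolding nn_integral_count_space_subset[OF reach_subset]
  proof (intro borel_measurable_nn_integral_count_space[OF countable_edges])
    fix j assume "j \<in> I"
    note [measurable] = measurable_compose[OF rot_measurable G[OF this], of t]
    have "(\<lambda>s. ?G j (rot t s) * indicator (reach I e (int_part t s) i) j)
        = (\<lambda>s. if j \<in> reach I e (int_part t s) i then ?G j (rot t s) else 0)"
      by (auto simp: indicator_def)
    then show "(\<lambda>s. ?G j (rot t s) * indicator (reach I e (int_part t s) i) j) \<in> borel_measurable unit_measure"
      by simp
  qed
  have "modular p I \<rho> (left_translation I e t f) \<le> (\<integral>\<^sup>+i. \<integral>\<^sup>+s. ennreal C * ?H i s \<partial>unit_measure \<partial>count_space I)"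
    unfolding modular_def
  proof (rule nn_integral_mono, rule nn_integral_mono_AE)
    fix i assume "i \<in> space (count_space I)"
    then have "i \<in> I" by simp
    show "AE s in unit_measure. ennreal (norm (left_translation I e t f i s) powr p * \<rho> i s) \<le> ennreal C * ?H i s"
      using translation_fibrewise[OF f C bound \<open>i \<in> I\<close>] AE_unit_measure_in
      by eventually_elim (simp add: left_translation_eq[OF _ t])
  qed
  also have "\<dots> = ennreal C * (\<integral>\<^sup>+i. \<integral>\<^sup>+s. ?H i s \<partial>unit_measure \<partial>count_space I)"
    using H by (simp add: nn_integral_cmult)
  also have "\<dots> \<le> ennreal C * modular p I \<rho> f"
    unfolding modular_def by (intro mult_left_mono nn_integral_reach_le G) auto
  finally show ?thesis .
qed

lemma translation_in_Lp_space:
  fixes f :: "('i, 'k::{real_normed_field, euclidean_space}) family"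
  assumes f: "f \<in> Lp_space p I \<rho>" and t: "0 \<le> t" and C: "0 \<le> C" and bound: "pointwise_bound C t"
  shows "left_translation I e t f \<in> Lp_space p I \<rho>"
proof -
  have "ennreal C * modular p I \<rho> f < \<infinity>"
    using f by (simp add: Lp_space_iff ennreal_mult_less_top)
  then show ?thesis
    using translation_measurable[OF assms] translation_modular_le[OF assms]
    by (auto simp: Lp_space_iff intro: le_less_trans)
qed

end

section \<open>Approximation by continuous functions that vanish near the ends\<close>

lemma tendsto_0_ennreal_iff:
  fixes f :: "'a \<Rightarrow> ennreal"
  shows "(f \<longlongrightarrow> 0) F \<longleftrightarrow> (\<forall>\<epsilon>>0. eventually (\<lambda>x. f x \<le> ennreal \<epsilon>) F)"
proof (intro iffI allI impI)
  fix \<epsilon> :: real assume f: "(f \<longlongrightarrow> 0) F" and "0 < \<epsilon>"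
  then have "eventually (\<lambda>x. f x < ennreal \<epsilon>) F"
    by (intro order_tendstoD(2)[OF f]) simp
  then show "eventually (\<lambda>x. f x \<le> ennreal \<epsilon>) F"
    by eventually_elim simp
next
  assume ev: "\<forall>\<epsilon>>0. eventually (\<lambda>x. f x \<le> ennreal \<epsilon>) F"
  show "(f \<longlongrightarrow> 0) F"
  proof (rule order_tendstoI)
    fix a :: ennreal assume "0 < a"
    then obtain b where b: "0 < b" "b < a" using dense by blast
    then have "b < top" using less_le_trans top_greatest by blast
    then obtain \<epsilon> where \<epsilon>: "b = ennreal \<epsilon>" "0 \<le> \<epsilon>" by (cases b) auto
    with b have "0 < \<epsilon>" by simp
    with ev have "eventually (\<lambda>x. f x \<le> ennreal \<epsilon>) F" by blast
    then show "eventually (\<lambda>x. f x < a) F"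
      by eventually_elim (use b \<epsilon> in auto)
  qed simp
qed

lemma tendsto_0_ennreal_powr:
  assumes "(f \<longlongrightarrow> 0) F" and p: "0 < p"
  shows "((\<lambda>x. ennreal_powr (f x) (1 / p)) \<longlongrightarrow> 0) F"
  unfolding tendsto_0_ennreal_iff
proof (intro allI impI)
  fix \<epsilon> :: real assume "0 < \<epsilon>"
  then have "eventually (\<lambda>x. f x \<le> ennreal (\<epsilon> powr p)) F"
    using assms(1) unfolding tendsto_0_ennreal_iff by simp
  then show "eventually (\<lambda>x. ennreal_powr (f x) (1 / p) \<le> ennreal \<epsilon>) F"
    using \<open>0 < \<epsilon>\<close> p by (simp add: ennreal_powr_inverse_le_iff)
qed

text \<open>
  Radial projection to the ball of radius \<open>B\<close>: a continuous truncation of vectors.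
\<close>

definition radial_clamp :: "real \<Rightarrow> 'k::real_normed_vector \<Rightarrow> 'k" where
  "radial_clamp B x = (B / max B (norm x)) *\<^sub>R x"

lemma radial_clamp_eq: "0 < B \<Longrightarrow> norm x \<le> B \<Longrightarrow> radial_clamp B x = x"
  by (simp add: radial_clamp_def max_def)

lemma norm_radial_clamp_le:
  assumes "0 < B"
  shows "norm (radial_clamp B x) \<le> B"
proof -
  have "B * norm x \<le> B * max B (norm x)"
    using assms by (intro mult_left_mono) auto
  then show ?thesis
    using assms by (simp add: radial_clamp_def field_simps max_def split: if_splits)
qed

lemma norm_diff_radial_clamp_le:
  assumes "0 < B"
  shows "norm (x - radial_clamp B x) \<le> norm x"
proof -
  have "x - radial_clamp B x = (1 - B / max B (norm x)) *\<^sub>R x"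
    by (simp add: radial_clamp_def scaleR_diff_left)
  moreover have "0 \<le> B / max B (norm x)" "B / max B (norm x) \<le> 1"
    using assms by (auto simp: max_def intro!: divide_le_eq_1_pos[THEN iffD2])
  then have "\<bar>1 - B / max B (norm x)\<bar> \<le> 1" by linarith
  ultimately show ?thesis
    using mult_right_mono[of "\<bar>1 - B / max B (norm x)\<bar>" 1 "norm x"] by simp
qed

lemma continuous_on_radial_clamp:
  "0 < B \<Longrightarrow> continuous_on A g \<Longrightarrow> continuous_on A (\<lambda>x. radial_clamp B (g x))"
  unfolding radial_clamp_def by (intro continuous_intros) (auto simp: max_def)

text \<open>
  Dominated convergence in the form in which it is used for weighted \<open>p\<close>-th powers.
\<close>

lemma nn_integral_tendsto_0_dominated:
  fixes u :: "nat \<Rightarrow> real \<Rightarrow> 'k::euclidean_space" and r b :: "real \<Rightarrow> real"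
  assumes p: "0 < p" and u: "\<And>n. u n \<in> borel_measurable M" and r: "r \<in> borel_measurable M" and b: "b \<in> borel_measurable M"
    and nonneg: "AE s in M. 0 \<le> r s"
    and lim: "AE s in M. (\<lambda>n. u n s) \<longlonglongrightarrow> 0"
    and dom: "\<And>n. AE s in M. norm (u n s) \<le> b s"
    and fin: "(\<integral>\<^sup>+s. ennreal (b s powr p * r s) \<partial>M) < \<infinity>"
  shows "(\<lambda>n. \<integral>\<^sup>+s. ennreal (norm (u n s) powr p * r s) \<partial>M) \<longlonglongrightarrow> 0"
proof -
  note [measurable] = u r b
  have "(\<lambda>n. \<integral>\<^sup>+s. ennreal (norm (u n s) powr p * r s) \<partial>M) \<longlonglongrightarrow> (\<integral>\<^sup>+s. 0 \<partial>M)"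
  proof (rule nn_integral_dominated_convergence[where w = "\<lambda>s. ennreal (b s powr p * r s)"])
    fix n show "AE s in M. ennreal (norm (u n s) powr p * r s) \<le> ennreal (b s powr p * r s)"
      using dom[of n] nonneg
    proof eventually_elim
      case (elim s)
      then show ?case using p by (intro ennreal_leI mult_right_mono powr_mono2) auto
    qed
  next
    show "AE s in M. (\<lambda>n. ennreal (norm (u n s) powr p * r s)) \<longlonglongrightarrow> 0"
      using lim
    proof eventually_elim
      case (elim s)
      have "(\<lambda>n. norm (u n s) powr p) \<longlonglongrightarrow> 0 powr p"
        using p tendsto_norm_zero[OF elim] by (intro tendsto_powr') auto
      then have "(\<lambda>n. norm (u n s) powr p * r s) \<longlonglongrightarrow> 0 * r s"
        using p by (intro tendsto_mult tendsto_const) simp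
      then have "(\<lambda>n. ennreal (norm (u n s) powr p * r s)) \<longlonglongrightarrow> ennreal 0"
        by (intro tendsto_ennrealI) simp
      then show ?case by simp
    qed
  qed (use fin in measurable)
  then show ?thesis by simp
qed

lemma continuous_borel_measurable_unit:
  fixes g :: "real \<Rightarrow> 'k::euclidean_space"
  assumes "continuous_on UNIV g"
  shows "g \<in> borel_measurable unit_measure"
  by (rule continuous_imp_measurable_on_sets_lebesgue) (auto intro: continuous_on_subset[OF assms])

text \<open>
  The margin \<open>\<delta>\<close> keeps the support away from both ends of the edge, so that translations by less
  than \<open>\<delta>\<close> do not carry any mass across a vertex.
\<close>

definition compactly_inside :: "real \<Rightarrow> (real \<Rightarrow> 'k::real_normed_vector) \<Rightarrow> bool" where
  "compactly_inside \<delta> g \<longleftrightarrow> continuous_on UNIV g \<and> bounded (range g) \<and> (\<forall>s. s \<notin> {\<delta>..1 - \<delta>} \<longrightarrow> g s = 0)"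

text \<open>
  A measurable function is almost everywhere a limit of continuous ones. Truncating these at the bound
  of \<open>f\<close> and multiplying by cutoff functions near the ends preserves the limit and provides an integrable majorant,
  because the weight is integrable.
\<close>

lemma compactly_inside_approximation_bounded:
  fixes f :: "real \<Rightarrow> 'k::euclidean_space"
  assumes p: "0 < p" and r: "integrable unit_measure r" "AE s in unit_measure. 0 < r s"
    and f: "f \<in> borel_measurable unit_measure" and B: "0 < B" "\<And>s. norm (f s) \<le> B" and \<epsilon>: "0 < \<epsilon>"
  shows "\<exists>g \<delta>. 0 < \<delta> \<and> compactly_inside \<delta> g \<and>
    (\<integral>\<^sup>+s. ennreal (norm (f s - g s) powr p * r s) \<partial>unit_measure) \<le> ennreal \<epsilon>"
proof -
  have "f measurable_on {0..<1}"
    using f by (simp add: measurable_on_iff_borel_measurable)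
  then obtain N h where N: "negligible N" and h: "\<And>n. continuous_on UNIV (h n)"
    and lim: "\<And>x. x \<notin> N \<Longrightarrow> (\<lambda>n. h n x) \<longlonglongrightarrow> (if x \<in> {0..<1} then f x else 0)"
    unfolding measurable_on_def by blast
  \<comment> \<open>The cutoff is zero within distance \<open>1 / n\<close> of an end, and one beyond distance \<open>2 / n\<close>.\<close>
  define \<phi> where "\<phi> n x = min 1 (max 0 (real n * min x (1 - x) - 1))" for n :: nat and x :: real
  define g where "g n x = \<phi> n x *\<^sub>R radial_clamp B (h n x)" for n x
  have cont: "continuous_on UNIV (g n)" for n
    unfolding g_def \<phi>_def by (intro continuous_intros continuous_on_radial_clamp B h)
  have le: "norm (g n x) \<le> B" for n x
    using mult_mono[of "\<bar>\<phi> n x\<bar>" 1 "norm (radial_clamp B (h n x))" B] norm_radial_clamp_le[OF B(1), of "h n x"] B(1)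
    by (simp add: g_def \<phi>_def)
  have inside: "compactly_inside (1 / real (Suc n)) (g (Suc n))" for n
    unfolding compactly_inside_def
  proof (intro conjI allI impI)
    show "bounded (range (g (Suc n)))"
      using le by (auto simp: bounded_iff)
    fix s assume "s \<notin> {1 / real (Suc n)..1 - 1 / real (Suc n)}"
    then have "min s (1 - s) < 1 / real (Suc n)" by auto
    then have "real (Suc n) * min s (1 - s) < 1"
      by (metis mult.commute of_nat_0_less_iff pos_less_divide_eq zero_less_Suc)
    then show "g (Suc n) s = 0" by (simp add: g_def \<phi>_def)
  qed (rule cont)
  have "AE s in lebesgue. s \<notin> N \<union> {0}"
    using N by (intro AE_not_in) (auto simp: negligible_iff_null_sets[symmetric])
  then have "AE s in unit_measure. s \<notin> N \<union> {0} \<and> s \<in> {0..<1}"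
    by (subst AE_restrict_space_iff) (auto elim: eventually_mono)
  then have "AE s in unit_measure. (\<lambda>n. f s - g n s) \<longlonglongrightarrow> 0"
  proof eventually_elim
    case (elim s)
    have "(\<lambda>n. h n s) \<longlonglongrightarrow> f s" using lim[of s] elim by simp
    then have "(\<lambda>n. (B / max B (norm (h n s))) *\<^sub>R h n s) \<longlonglongrightarrow> (B / max B (norm (f s))) *\<^sub>R f s"
      using B(1) by (intro tendsto_intros) (auto simp: max_def)
    then have "(\<lambda>n. radial_clamp B (h n s)) \<longlonglongrightarrow> f s"
      using radial_clamp_eq[OF B(1) B(2)[of s]] by (simp add: radial_clamp_def)
    moreover have "(\<lambda>n. \<phi> n s) \<longlonglongrightarrow> 1"
    proof (rule tendsto_eventually)
      have d: "0 < min s (1 - s)" using elim by auto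
      have "eventually (\<lambda>n. real n \<ge> 2 / min s (1 - s)) sequentially"
        by (rule eventually_sequentiallyI[of "nat \<lceil>2 / min s (1 - s)\<rceil>"]) linarith
      then show "eventually (\<lambda>n. \<phi> n s = 1) sequentially"
      proof eventually_elim
        case (elim n)
        then have "2 \<le> real n * min s (1 - s)" using d by (simp add: pos_divide_le_eq)
        then show ?case by (simp add: \<phi>_def)
      qed
    qed
    ultimately have "(\<lambda>n. g n s) \<longlonglongrightarrow> 1 *\<^sub>R f s"
      unfolding g_def by (intro tendsto_scaleR)
    then show ?case
      using tendsto_diff[OF tendsto_const[of "f s"]] by fastforce
  qed
  then have "(\<lambda>n. \<integral>\<^sup>+s. ennreal (norm (f s - g n s) powr p * r s) \<partial>unit_measure) \<longlonglongrightarrow> 0"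
  proof (rule nn_integral_tendsto_0_dominated[where b = "\<lambda>_. 2 * B", rotated 5])
    fix n show "(\<lambda>s. f s - g n s) \<in> borel_measurable unit_measure"
      using f continuous_borel_measurable_unit[OF cont] by (rule borel_measurable_diff)
    show "AE s in unit_measure. norm (f s - g n s) \<le> 2 * B"
    proof (rule AE_I2)
      fix s show "norm (f s - g n s) \<le> 2 * B"
        using norm_triangle_ineq4[of "f s" "g n s"] B(2)[of s] le[of n s] by linarith
    qed
    show "AE s in unit_measure. 0 \<le> r s" using r(2) by eventually_elim simp
    have "integrable unit_measure (\<lambda>s. (2 * B) powr p * r s)"
      using r(1) by (rule integrable_mult_right)
    moreover have "AE s in unit_measure. 0 \<le> (2 * B) powr p * r s"
      using r(2) by eventually_elim simp
    ultimately show "(\<integral>\<^sup>+s. ennreal ((2 * B) powr p * r s) \<partial>unit_measure) < \<infinity>"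
      by (simp add: nn_integral_eq_integral)
  qed (use p r in auto)
  then have "eventually (\<lambda>n. (\<integral>\<^sup>+s. ennreal (norm (f s - g n s) powr p * r s) \<partial>unit_measure) \<le> ennreal \<epsilon>) sequentially"
    using \<epsilon> unfolding tendsto_0_ennreal_iff by blast
  then obtain n where "(\<integral>\<^sup>+s. ennreal (norm (f s - g (Suc n) s) powr p * r s) \<partial>unit_measure) \<le> ennreal \<epsilon>"
    unfolding eventually_sequentially using le_SucI by blast
  then show ?thesis
    using inside[of n] by (intro exI[of _ "g (Suc n)"] exI[of _ "1 / real (Suc n)"]) simp
qed

text \<open>
  Truncation reduces the general case to bounded functions, with \<open>f\<close> itself as majorant.
\<close>

lemma compactly_inside_approximation:
  fixes f :: "real \<Rightarrow> 'k::euclidean_space"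
  assumes p: "1 \<le> p" and r: "integrable unit_measure r" "AE s in unit_measure. 0 < r s"
    and f: "f \<in> borel_measurable unit_measure"
    and fin: "(\<integral>\<^sup>+s. ennreal (norm (f s) powr p * r s) \<partial>unit_measure) < \<infinity>" and \<epsilon>: "0 < \<epsilon>"
  shows "\<exists>g \<delta>. 0 < \<delta> \<and> compactly_inside \<delta> g \<and>
    (\<integral>\<^sup>+s. ennreal (norm (f s - g s) powr p * r s) \<partial>unit_measure) \<le> ennreal \<epsilon>"
proof -
  define \<eta> where "\<eta> = \<epsilon> / (2 * 2 powr p)"
  have \<eta>: "0 < \<eta>" using \<epsilon> by (simp add: \<eta>_def)
  have rm: "r \<in> borel_measurable unit_measure" using r(1) by (rule borel_measurable_integrable)
  define c where "c n s = radial_clamp (real (Suc n)) (f s)" for n s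
  have cm: "c n \<in> borel_measurable unit_measure" for n
    unfolding c_def
    by (rule borel_measurable_continuous_on[OF _ f]) (auto intro!: continuous_on_radial_clamp continuous_on_id)
  have "(\<lambda>n. \<integral>\<^sup>+s. ennreal (norm (f s - c n s) powr p * r s) \<partial>unit_measure) \<longlonglongrightarrow> 0"
  proof (rule nn_integral_tendsto_0_dominated[where b = "\<lambda>s. norm (f s)"])
    fix n
    show "(\<lambda>s. f s - c n s) \<in> borel_measurable unit_measure"
      using f cm by (rule borel_measurable_diff)
    show "AE s in unit_measure. norm (f s - c n s) \<le> norm (f s)"
      by (rule AE_I2) (simp add: c_def norm_diff_radial_clamp_le)
  next
    have "eventually (\<lambda>n. f s - c n s = 0) sequentially" for s
    proof (rule eventually_sequentiallyI)
      fix n assume "nat \<lceil>norm (f s)\<rceil> \<le> n"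
      then have "norm (f s) \<le> real (Suc n)" by linarith
      then show "f s - c n s = 0" by (simp add: c_def radial_clamp_eq)
    qed
    then show "AE s in unit_measure. (\<lambda>n. f s - c n s) \<longlonglongrightarrow> 0"
      by (intro AE_I2 tendsto_eventually)
    show "AE s in unit_measure. 0 \<le> r s" using r(2) by eventually_elim simp
  qed (use p rm f fin in auto)
  then have "eventually (\<lambda>n. (\<integral>\<^sup>+s. ennreal (norm (f s - c n s) powr p * r s) \<partial>unit_measure) \<le> ennreal \<eta>) sequentially"
    using \<eta> unfolding tendsto_0_ennreal_iff by blast
  then obtain n where n: "(\<integral>\<^sup>+s. ennreal (norm (f s - c n s) powr p * r s) \<partial>unit_measure) \<le> ennreal \<eta>"
    unfolding eventually_sequentially by blast
  have "\<exists>g \<delta>. 0 < \<delta> \<and> compactly_inside \<delta> g \<and>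
    (\<integral>\<^sup>+s. ennreal (norm (c n s - g s) powr p * r s) \<partial>unit_measure) \<le> ennreal \<eta>"
    using p by (intro compactly_inside_approximation_bounded[where B = "real (Suc n)"] r cm \<eta>)
      (auto simp: c_def intro!: norm_radial_clamp_le[of "real (Suc n)", simplified])
  then obtain g \<delta> where g: "0 < \<delta>" "compactly_inside \<delta> g"
    "(\<integral>\<^sup>+s. ennreal (norm (c n s - g s) powr p * r s) \<partial>unit_measure) \<le> ennreal \<eta>" by blast
  have gm: "g \<in> borel_measurable unit_measure"
    using g(2) by (intro continuous_borel_measurable_unit) (simp add: compactly_inside_def)
  \<comment> \<open>Over a one-element index set the modular is the plain weighted integral.\<close>
  interpret weighted_edges "{()}" "\<lambda>_. ((), ())" "\<lambda>_. r" p
    by unfold_locales (use p r in \<open>auto simp: weight_def\<close>)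
  have "modular p {()} (\<lambda>_. r) (\<lambda>i s. (f s - c n s) + (c n s - g s))
      \<le> ennreal (2 powr p) * (modular p {()} (\<lambda>_. r) (\<lambda>_ s. f s - c n s) + modular p {()} (\<lambda>_. r) (\<lambda>_ s. c n s - g s))"
    using f cm gm by (intro modular_add_le borel_measurable_diff)
  also have "\<dots> \<le> ennreal (2 powr p) * (ennreal \<eta> + ennreal \<eta>)"
    using n g(3) by (intro mult_left_mono add_mono) (auto simp: modular_def nn_integral_count_space_finite)
  also have "\<dots> = ennreal \<epsilon>"
    using \<eta> by (simp add: ennreal_plus[symmetric] ennreal_mult[symmetric] del: ennreal_plus) (simp add: \<eta>_def)
  finally have "(\<integral>\<^sup>+s. ennreal (norm (f s - g s) powr p * r s) \<partial>unit_measure) \<le> ennreal \<epsilon>"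
    by (simp add: modular_def nn_integral_count_space_finite)
  then show ?thesis using g by blast
qed

context weighted_edges
begin

lemma Lp_space_add:
  fixes f g :: "('i, 'k::euclidean_space) family"
  assumes f: "f \<in> Lp_space p I \<rho>" and g: "g \<in> Lp_space p I \<rho>"
  shows "(\<lambda>i s. f i s + g i s) \<in> Lp_space p I \<rho>"
  unfolding Lp_space_iff
proof
  show "\<forall>i\<in>I. (\<lambda>s. f i s + g i s) \<in> borel_measurable unit_measure"
    using f g by (auto simp: Lp_space_iff intro: borel_measurable_add)
  have "modular p I \<rho> (\<lambda>i s. f i s + g i s) \<le> ennreal (2 powr p) * (modular p I \<rho> f + modular p I \<rho> g)"
    using f g by (intro modular_add_le) (auto simp: Lp_space_iff)
  also have "\<dots> < \<infinity>"
    using f g by (auto simp: Lp_space_iff ennreal_mult_less_top)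
  finally show "modular p I \<rho> (\<lambda>i s. f i s + g i s) < \<infinity>" .
qed

lemma Lp_space_diff:
  fixes f g :: "('i, 'k::{real_normed_field, euclidean_space}) family"
  assumes f: "f \<in> Lp_space p I \<rho>" and g: "g \<in> Lp_space p I \<rho>"
  shows "(\<lambda>i s. f i s - g i s) \<in> Lp_space p I \<rho>"
proof -
  have "modular p I \<rho> (\<lambda>i s. - g i s) = modular p I \<rho> g"
    by (simp add: modular_def)
  then have "(\<lambda>i s. - g i s) \<in> Lp_space p I \<rho>"
    using g by (auto simp: Lp_space_iff intro: borel_measurable_uminus)
  from Lp_space_add[OF f this] show ?thesis by simp
qed

text \<open>
  All but finitely many edges carry an arbitrarily small part of the norm and can be dropped; on each of the
  others the function is approximated separately. As they are finitely many, a common margin \<open>\<delta>\<close> exists.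
\<close>

lemma compactly_inside_approximation_family:
  fixes f :: "('i, 'k::{real_normed_field, euclidean_space}) family"
  assumes f: "f \<in> Lp_space p I \<rho>" and \<epsilon>: "0 < \<epsilon>"
  obtains g \<delta> F where "finite F" "F \<subseteq> I" "0 < \<delta>" "\<And>i. compactly_inside \<delta> (g i)"
    "\<And>i. i \<notin> F \<Longrightarrow> g i = (\<lambda>_. 0)" "modular p I \<rho> (\<lambda>i s. f i s - g i s) \<le> ennreal \<epsilon>"
proof -
  define m where "m i = (\<integral>\<^sup>+s. ennreal (norm (f i s) powr p * \<rho> i s) \<partial>unit_measure)" for i
  have split: "(\<integral>\<^sup>+i. u i \<partial>count_space I) = sum u F + (\<integral>\<^sup>+i. u i * indicator (- F) i \<partial>count_space I)"
    if "finite F" "F \<subseteq> I" for u :: "'i \<Rightarrow> ennreal" and F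
  proof -
    have "(\<integral>\<^sup>+i. u i \<partial>count_space I) = (\<integral>\<^sup>+i. u i * indicator F i + u i * indicator (- F) i \<partial>count_space I)"
      by (intro nn_integral_cong) (auto simp: indicator_def)
    also have "\<dots> = (\<integral>\<^sup>+i. u i * indicator F i \<partial>count_space I) + (\<integral>\<^sup>+i. u i * indicator (- F) i \<partial>count_space I)"
      by (rule nn_integral_add) auto
    finally show ?thesis
      using that by (simp add: nn_integral_count_space_subset[symmetric] nn_integral_count_space_finite)
  qed
  have mod: "modular p I \<rho> f = infsum m I"
    unfolding modular_def m_def by (rule infsum_ennreal_eq_nn_integral[OF countable_edges, symmetric])
  have fin: "infsum m I < \<infinity>" using f mod by (simp add: Lp_space_iff)
  obtain F where F: "finite F" "F \<subseteq> I" "infsum m I \<le> sum m F + ennreal (\<epsilon> / 2)"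
  proof (cases "infsum m I = 0")
    case False
    then have "infsum m I - ennreal (\<epsilon> / 2) < infsum m I"
      using fin \<epsilon> by (intro ennreal_between) (auto simp: zero_less_iff_neq_zero)
    moreover have "\<exists>F\<in>{F. finite F \<and> F \<subseteq> I}. c < sum m F" if "c < infsum m I" for c
      using that unfolding infsum_ennreal_eq_SUP less_SUP_iff .
    ultimately have "\<exists>F\<in>{F. finite F \<and> F \<subseteq> I}. infsum m I - ennreal (\<epsilon> / 2) < sum m F"
      by blast
    then obtain F where "finite F" "F \<subseteq> I" and lt: "infsum m I - ennreal (\<epsilon> / 2) < sum m F"
      by blast
    have "infsum m I \<le> ennreal (\<epsilon> / 2) + sum m F"
      using less_imp_le[OF lt] by (simp only: ennreal_minus_le_iff)
    then show ?thesis
      using that[of F] \<open>finite F\<close> \<open>F \<subseteq> I\<close> by (simp add: add.commute)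
  qed (use that[of "{}"] in simp)
  have sumF: "sum m F \<noteq> \<infinity>"
    using finite_sum_le_infsum_ennreal[OF F(1,2), of m] fin by (auto simp: top_unique)
  have "sum m F + (\<integral>\<^sup>+i. m i * indicator (- F) i \<partial>count_space I) \<le> sum m F + ennreal (\<epsilon> / 2)"
    using F(3) split[OF F(1,2), of m] infsum_ennreal_eq_nn_integral[OF countable_edges, of m] by simp
  then have tail: "(\<integral>\<^sup>+i. m i * indicator (- F) i \<partial>count_space I) \<le> ennreal (\<epsilon> / 2)"
    using sumF by (simp add: ennreal_add_left_cancel_le)
  define \<eta> where "\<eta> = \<epsilon> / (2 * (real (card F) + 1))"
  have \<eta>: "0 < \<eta>" using \<epsilon> by (simp add: \<eta>_def)
  define good where "good i u d \<longleftrightarrow> 0 < d \<and> compactly_inside d u \<and>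
      (\<integral>\<^sup>+s. ennreal (norm (f i s - u s) powr p * \<rho> i s) \<partial>unit_measure) \<le> ennreal \<eta>" for i u d
  have "\<exists>u d. good i u d" if "i \<in> F" for i
  proof -
    have i: "i \<in> I" using that F by blast
    have "m i \<le> infsum m I"
      using finite_sum_le_infsum_ennreal[of "{i}" I m] i by simp
    then have "m i < \<infinity>" using fin by (rule le_less_trans)
    then show ?thesis
      using i f weight \<eta> unfolding good_def
      by (intro compactly_inside_approximation[OF p_ge_1]) (auto simp: weight_def Lp_space_iff m_def)
  qed
  then obtain g0 \<delta>0 where "\<And>i. i \<in> F \<Longrightarrow> good i (g0 i) (\<delta>0 i)"
    by metis
  then have g0: "\<And>i. i \<in> F \<Longrightarrow> 0 < \<delta>0 i" "\<And>i. i \<in> F \<Longrightarrow> compactly_inside (\<delta>0 i) (g0 i)"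
      "\<And>i. i \<in> F \<Longrightarrow> (\<integral>\<^sup>+s. ennreal (norm (f i s - g0 i s) powr p * \<rho> i s) \<partial>unit_measure) \<le> ennreal \<eta>"
    unfolding good_def by blast+
  define g where "g i = (if i \<in> F then g0 i else (\<lambda>_. 0))" for i
  define \<delta> where "\<delta> = Min (insert (1 / 2) (\<delta>0 ` F))"
  have \<delta>: "0 < \<delta>" using F g0(1) by (simp add: \<delta>_def)
  have \<delta>_le: "\<delta> \<le> \<delta>0 i" if "i \<in> F" for i using that F by (simp add: \<delta>_def)
  show ?thesis
  proof (rule that[OF F(1,2) \<delta>])
    show "compactly_inside \<delta> (g i)" for i
    proof (cases "i \<in> F")
      case True
      then show ?thesis using g0(2)[OF True] \<delta>_le[OF True] by (auto simp: compactly_inside_def g_def)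
    qed (auto simp: g_def compactly_inside_def image_constant_conv)
    show "g i = (\<lambda>_. 0)" if "i \<notin> F" for i using that by (simp add: g_def)
    let ?d = "\<lambda>i. \<integral>\<^sup>+s. ennreal (norm (f i s - g i s) powr p * \<rho> i s) \<partial>unit_measure"
    have "modular p I \<rho> (\<lambda>i s. f i s - g i s) = sum ?d F + (\<integral>\<^sup>+i. ?d i * indicator (- F) i \<partial>count_space I)"
      unfolding modular_def by (rule split[OF F(1,2)])
    also have "(\<integral>\<^sup>+i. ?d i * indicator (- F) i \<partial>count_space I) = (\<integral>\<^sup>+i. m i * indicator (- F) i \<partial>count_space I)"
      by (intro nn_integral_cong) (auto simp: indicator_def g_def m_def)
    also have "sum ?d F \<le> sum (\<lambda>_. ennreal \<eta>) F"
      by (rule sum_mono) (simp add: g_def g0(3))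
    also have "sum (\<lambda>_. ennreal \<eta>) F = ennreal (real (card F) * \<eta>)"
      using \<eta> by (simp add: ennreal_mult ennreal_of_nat_eq_real_of_nat)
    also have "\<dots> \<le> ennreal (\<epsilon> / 2)"
      using \<epsilon> by (intro ennreal_leI) (simp add: \<eta>_def field_simps)
    also note tail
    finally have "modular p I \<rho> (\<lambda>i s. f i s - g i s) \<le> ennreal (\<epsilon> / 2) + ennreal (\<epsilon> / 2)"
      by (simp add: add_mono)
    then show "modular p I \<rho> (\<lambda>i s. f i s - g i s) \<le> ennreal \<epsilon>"
      using \<epsilon> by (simp add: ennreal_plus[symmetric] del: ennreal_plus)
  qed
qed

section \<open>Algebraic properties and small translations\<close>

text \<open>
  A translation by less than the margin acts on each edge as an ordinary shift: a point that leaves the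
  edge arrives in the initial piece of the next edges, where the family vanishes, and
  the shifted function on the original edge vanishes there as well.
\<close>

lemma translation_compactly_inside:
  fixes g :: "('i, 'k::{real_normed_field, euclidean_space}) family"
  assumes g: "\<And>i. compactly_inside \<delta> (g i)" and h: "0 \<le> h" "h < \<delta>" "h < 1" and i: "i \<in> I" and s: "s \<in> {0..<1}"
  shows "left_translation I e h g i s = g i (s + h)"
proof (cases "s + h < 1")
  case True
  then have "int_part h s = 0" using s h by (simp add: int_part_def)
  then show ?thesis
    using i by (simp add: left_translation_def reach_0 add.commute)
next
  case False
  then have n: "int_part h s = 1"
    using s h unfolding int_part_def by (simp add: floor_eq_iff nat_eq_iff)
  have "left_translation I e h g i s = (\<Sum>\<^sub>\<infinity>j\<in>reach I e 1 i. g j (h + s - 1))"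
    using n by (simp add: left_translation_def)
  also have "\<dots> = 0"
    using g s h by (intro infsum_0) (auto simp: compactly_inside_def)
  also have "0 = g i (s + h)"
    using g[of i] False h by (auto simp: compactly_inside_def)
  finally show ?thesis .
qed

text \<open>
  The shifts converge pointwise by continuity, only finitely many edges are involved, and on each of them
  the bound of the function gives an integrable majorant.
\<close>

lemma translation_compactly_inside_tendsto:
  fixes g :: "('i, 'k::{real_normed_field, euclidean_space}) family"
  assumes F: "finite F" "F \<subseteq> I" and \<delta>: "0 < \<delta>" and g: "\<And>i. compactly_inside \<delta> (g i)"
    and g0: "\<And>i. i \<notin> F \<Longrightarrow> g i = (\<lambda>_. 0)"
  shows "((\<lambda>h. modular p I \<rho> (\<lambda>i s. left_translation I e h g i s - g i s)) \<longlongrightarrow> 0) (at_right 0)"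
  unfolding tendsto_at_iff_sequentially
proof (intro allI impI)
  fix h :: "nat \<Rightarrow> real" assume h: "\<forall>n. h n \<in> {0<..} - {0}" "h \<longlonglongrightarrow> 0"
  have gc: "continuous_on UNIV (g i)" and gb: "bounded (range (g i))" for i
    using g[of i] by (auto simp: compactly_inside_def)
  have shift: "continuous_on UNIV (\<lambda>s. g i (s + c))" for i c
    by (rule continuous_on_compose2[OF gc]) (auto intro!: continuous_intros)
  have "(\<lambda>n. \<Sum>i\<in>F. \<integral>\<^sup>+s. ennreal (norm (g i (s + h n) - g i s) powr p * \<rho> i s) \<partial>unit_measure) \<longlonglongrightarrow> (\<Sum>i\<in>F. 0)"
  proof (rule tendsto_sum)
    fix i assume "i \<in> F"
    then have i: "i \<in> I" using F by blast
    have pos: "AE s in unit_measure. 0 \<le> \<rho> i s"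
      using AE_weight_pos by eventually_elim (use i in \<open>auto intro: less_imp_le\<close>)
    obtain B where B: "\<And>s. norm (g i s) \<le> B"
      using gb[of i] by (auto simp: bounded_iff)
    show "(\<lambda>n. \<integral>\<^sup>+s. ennreal (norm (g i (s + h n) - g i s) powr p * \<rho> i s) \<partial>unit_measure) \<longlonglongrightarrow> 0"
    proof (rule nn_integral_tendsto_0_dominated[where b = "\<lambda>_. 2 * B"])
      fix n
      show "(\<lambda>s. g i (s + h n) - g i s) \<in> borel_measurable unit_measure"
        by (intro continuous_borel_measurable_unit continuous_on_diff shift gc)
      show "AE s in unit_measure. norm (g i (s + h n) - g i s) \<le> 2 * B"
      proof (rule AE_I2)
        fix s show "norm (g i (s + h n) - g i s) \<le> 2 * B"
          using norm_triangle_ineq4[of "g i (s + h n)" "g i s"] B[of s] B[of "s + h n"] by linarith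
      qed
    next
      show "AE s in unit_measure. (\<lambda>n. g i (s + h n) - g i s) \<longlonglongrightarrow> 0"
      proof (rule AE_I2)
        fix s
        have "(\<lambda>n. s + h n) \<longlonglongrightarrow> s + 0" by (intro tendsto_intros h)
        then have "(\<lambda>n. g i (s + h n)) \<longlonglongrightarrow> g i (s + 0)"
          by (intro continuous_on_tendsto_compose[OF gc]) auto
        then show "(\<lambda>n. g i (s + h n) - g i s) \<longlonglongrightarrow> 0"
          by (simp add: LIM_zero_iff)
      qed
      have "integrable unit_measure (\<lambda>s. (2 * B) powr p * \<rho> i s)"
        using weight_integrable[OF i] by (rule integrable_mult_right)
      moreover have "AE s in unit_measure. 0 \<le> (2 * B) powr p * \<rho> i s"
        using pos by eventually_elim simp
      ultimately show "(\<integral>\<^sup>+s. ennreal ((2 * B) powr p * \<rho> i s) \<partial>unit_measure) < \<infinity>"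
        by (simp add: nn_integral_eq_integral)
    qed (use p_ge_1 pos weight_measurable[OF i] in auto)
  qed
  moreover have "eventually (\<lambda>n. (\<Sum>i\<in>F. \<integral>\<^sup>+s. ennreal (norm (g i (s + h n) - g i s) powr p * \<rho> i s) \<partial>unit_measure)
      = modular p I \<rho> (\<lambda>i s. left_translation I e (h n) g i s - g i s)) sequentially"
  proof -
    have "eventually (\<lambda>n. h n < min \<delta> 1) sequentially"
      using h(2) \<delta> by (intro order_tendstoD) auto
    then show ?thesis
    proof eventually_elim
      case (elim n)
      have hn: "0 \<le> h n" "h n < \<delta>" "h n < 1" using h(1) elim by (auto simp: less_imp_le)
      let ?d = "\<lambda>i. \<integral>\<^sup>+s. ennreal (norm (g i (s + h n) - g i s) powr p * \<rho> i s) \<partial>unit_measure"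
      have "modular p I \<rho> (\<lambda>i s. left_translation I e (h n) g i s - g i s) = (\<integral>\<^sup>+i. ?d i \<partial>count_space I)"
        unfolding modular_def
        by (intro nn_integral_cong) (auto simp: translation_compactly_inside[OF g hn])
      also have "\<dots> = (\<integral>\<^sup>+i. ?d i * indicator F i \<partial>count_space I)"
        by (intro nn_integral_cong) (auto simp: indicator_def g0)
      also have "\<dots> = sum ?d F"
        using F by (simp add: nn_integral_count_space_subset[symmetric] nn_integral_count_space_finite)
      finally show ?case by simp
    qed
  qed
  ultimately show "((\<lambda>h. modular p I \<rho> (\<lambda>i s. left_translation I e h g i s - g i s)) \<circ> h) \<longlonglongrightarrow> 0"
    unfolding o_def by (simp add: Lim_transform_eventually)
qed

lemma translation_0:
  fixes f :: "('i, 'k::{real_normed_field, euclidean_space}) family"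
  shows "ae_eq I (left_translation I e 0 f) f"
  unfolding ae_eq_def
proof
  fix i assume i: "i \<in> I"
  show "AE s in unit_measure. left_translation I e 0 f i s = f i s"
    using AE_unit_measure_in
  proof eventually_elim
    case (elim s)
    then have "int_part 0 s = 0" by (simp add: int_part_def)
    then show ?case using i by (simp add: left_translation_def reach_0)
  qed
qed

lemma translation_cong:
  fixes f g :: "('i, 'k::{real_normed_field, euclidean_space}) family"
  assumes fg: "ae_eq I f g" and t: "0 \<le> t"
  shows "ae_eq I (left_translation I e t f) (left_translation I e t g)"
  unfolding ae_eq_def
proof
  fix i assume i: "i \<in> I"
  have "AE s in unit_measure. \<forall>j\<in>I. f j s = g j s"
    using fg countable_edges by (simp add: ae_eq_def AE_ball_countable)
  from AE_rot[OF this, of t] AE_unit_measure_in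
  show "AE s in unit_measure. left_translation I e t f i s = left_translation I e t g i s"
  proof eventually_elim
    case (elim s)
    then show ?case
      using reach_subset by (auto simp: left_translation_eq[OF _ t] intro!: infsum_cong)
  qed
qed

lemma translation_scale:
  fixes f :: "('i, 'k::{real_normed_field, euclidean_space}) family"
  shows "left_translation I e t (\<lambda>i s. c * f i s) = (\<lambda>i s. c * left_translation I e t f i s)"
  by (intro ext) (simp add: left_translation_def infsum_cmult_right')

lemma translation_add:
  fixes f g :: "('i, 'k::{real_normed_field, euclidean_space}) family"
  assumes f: "f \<in> Lp_space p I \<rho>" and g: "g \<in> Lp_space p I \<rho>"
    and t: "0 \<le> t" and C: "0 \<le> C" and bound: "pointwise_bound C t"
  shows "ae_eq I (left_translation I e t (\<lambda>i s. f i s + g i s))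
    (\<lambda>i s. left_translation I e t f i s + left_translation I e t g i s)"
  unfolding ae_eq_def
proof
  fix i assume i: "i \<in> I"
  show "AE s in unit_measure. left_translation I e t (\<lambda>i s. f i s + g i s) i s
      = left_translation I e t f i s + left_translation I e t g i s"
    using translation_summable[OF f C bound i] translation_summable[OF g C bound i] AE_unit_measure_in
    by eventually_elim (simp add: left_translation_eq[OF _ t] infsum_add)
qed

text \<open>
  The fibre at time \<open>t + s\<close> is the disjoint union of the fibres at time \<open>s\<close> over the members of the fibre
  at time \<open>t\<close>. Almost everywhere the sum over it converges and may therefore be grouped.
\<close>

lemma translation_semigroup:
  fixes f :: "('i, 'k::{real_normed_field, euclidean_space}) family"
  assumes f: "f \<in> Lp_space p I \<rho>" and t: "0 \<le> t" and s: "0 \<le> s"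
    and C: "0 \<le> C" and bound: "pointwise_bound C (t + s)"
  shows "ae_eq I (left_translation I e (t + s) f) (left_translation I e t (left_translation I e s f))"
  unfolding ae_eq_def
proof
  fix i assume i: "i \<in> I"
  show "AE x in unit_measure. left_translation I e (t + s) f i x = left_translation I e t (left_translation I e s f) i x"
    using translation_summable[OF f C bound i] AE_unit_measure_in
  proof eventually_elim
    case (elim x)
    define n m where "n = int_part t x" and "m = int_part s (rot t x)"
    define a where "a j = f j (rot (t + s) x)" for j
    let ?S = "Sigma (reach I e n i) (reach I e m)"
    have nm: "int_part (t + s) x = n + m"
      using int_part_add[OF elim(2) t s] by (simp add: n_def m_def)
    have bij: "bij_betw snd ?S (reach I e (n + m) i)"
      unfolding bij_betw_def
    proof
      show "inj_on snd ?S"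
        using reach_source_unique by (auto simp: inj_on_def)
      show "snd ` ?S = reach I e (n + m) i"
        by (force simp: reach_add)
    qed
    have "(\<lambda>x. a (snd x)) summable_on ?S"
      using elim(1) summable_on_reindex_bij_betw[OF bij, of a] by (simp add: nm a_def[abs_def])
    then have sum: "(\<lambda>(k, j). a j) summable_on ?S"
      by (simp add: case_prod_unfold)
    have "left_translation I e t (left_translation I e s f) i x
        = (\<Sum>\<^sub>\<infinity>k\<in>reach I e n i. left_translation I e s f k (rot t x))"
      using elim t by (simp add: left_translation_eq n_def)
    also have "\<dots> = (\<Sum>\<^sub>\<infinity>k\<in>reach I e n i. \<Sum>\<^sub>\<infinity>j\<in>reach I e m k. a j)"
      using s rot_bounds[of t x] by (simp add: left_translation_eq m_def a_def rot_rot)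
    also have "\<dots> = (\<Sum>\<^sub>\<infinity>(k, j)\<in>?S. a j)"
      by (rule infsum_Sigma'_banach[OF sum])
    also have "\<dots> = (\<Sum>\<^sub>\<infinity>j\<in>reach I e (n + m) i. a j)"
      using infsum_reindex_bij_betw[OF bij, of a] by (simp add: case_prod_unfold)
    also have "\<dots> = left_translation I e (t + s) f i x"
      using elim t s by (simp add: left_translation_eq nm a_def)
    finally show ?case by simp
  qed
qed

end

section \<open>Strong continuity\<close>

text \<open>
  \<open>C t\<close> bounds the \<open>p\<close>-th power of the norm of the translation by \<open>t\<close>. Its local boundedness is what carries
  strong continuity from a dense subspace to the whole space.
\<close>

locale bounded_translation = weighted_edges I e \<rho> p
  for I :: "'i set" and e :: "'i \<Rightarrow> 'v \<times> 'v" and \<rho> :: "('i, real) family" and p :: real +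
  fixes C :: "real \<Rightarrow> real"
  assumes C_nonneg: "0 \<le> t \<Longrightarrow> 0 \<le> C t"
    and bound: "0 \<le> t \<Longrightarrow> pointwise_bound (C t) t"
    and C_locally_bounded: "\<exists>C0\<ge>0. \<forall>t. 0 \<le> t \<longrightarrow> t \<le> b \<longrightarrow> C t \<le> C0"
begin

text \<open>
  With \<open>g\<close> an approximation of \<open>f\<close>, the difference \<open>T h f - f\<close> splits into \<open>T h (f - g)\<close>,
  \<open>T h g - g\<close> and \<open>g - f\<close>. The first is controlled by the uniform bound, the second by continuity on nice families, and the third
  by the choice of \<open>g\<close>.
\<close>

lemma translation_tendsto_at_0:
  fixes f :: "('i, 'k::{real_normed_field, euclidean_space}) family"
  assumes f: "f \<in> Lp_space p I \<rho>"
  shows "((\<lambda>h. modular p I \<rho> (\<lambda>i s. left_translation I e h f i s - f i s)) \<longlongrightarrow> 0) (at_right 0)"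
  unfolding tendsto_0_ennreal_iff
proof (intro allI impI)
  fix \<epsilon> :: real assume \<epsilon>: "0 < \<epsilon>"
  obtain C0 where C0: "0 \<le> C0" "\<And>t. 0 \<le> t \<Longrightarrow> t \<le> 1 \<Longrightarrow> C t \<le> C0"
    using C_locally_bounded[of 1] by blast
  \<comment> \<open>The two quasi-triangle inequalities below give the bound \<open>D * \<eta>\<close> for all three terms together.\<close>
  define D where "D = 2 powr p * (C0 + 2 powr p * 2)"
  have D: "0 < D" using C0(1) by (simp add: D_def add_nonneg_pos)
  define \<eta> where "\<eta> = \<epsilon> / D"
  have \<eta>: "0 < \<eta>" using \<epsilon> D by (simp add: \<eta>_def)
  obtain g \<delta> F where F: "finite F" "F \<subseteq> I" and \<delta>: "0 < \<delta>" and g: "\<And>i. compactly_inside \<delta> (g i)"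
    and g0: "\<And>i. i \<notin> F \<Longrightarrow> g i = (\<lambda>_. 0)" and fg: "modular p I \<rho> (\<lambda>i s. f i s - g i s) \<le> ennreal \<eta>"
    by (rule compactly_inside_approximation_family[OF f \<eta>]) blast
  have fgL: "(\<lambda>i s. f i s - g i s) \<in> Lp_space p I \<rho>"
    unfolding Lp_space_iff
  proof (intro conjI ballI)
    fix i assume "i \<in> I"
    then show "(\<lambda>s. f i s - g i s) \<in> borel_measurable unit_measure"
      using f g[of i] by (intro borel_measurable_diff[OF _ continuous_borel_measurable_unit])
        (auto simp: Lp_space_iff compactly_inside_def)
  next
    show "modular p I \<rho> (\<lambda>i s. f i s - g i s) < \<infinity>"
      using fg by (rule le_less_trans) simp
  qed
  have gL: "g \<in> Lp_space p I \<rho>"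
    using Lp_space_diff[OF f fgL] by simp
  have "eventually (\<lambda>h. modular p I \<rho> (\<lambda>i s. left_translation I e h g i s - g i s) \<le> ennreal \<eta>) (at_right 0)"
    using translation_compactly_inside_tendsto[where g = g, OF F \<delta> g g0] \<eta> unfolding tendsto_0_ennreal_iff by blast
  moreover have "eventually (\<lambda>h::real. h \<in> {0<..<1}) (at_right 0)"
    by (rule eventually_at_right_real) simp
  ultimately show "eventually (\<lambda>h. modular p I \<rho> (\<lambda>i s. left_translation I e h f i s - f i s) \<le> ennreal \<epsilon>) (at_right 0)"
  proof eventually_elim
    case (elim h)
    then have h: "0 \<le> h" "h \<le> 1" by auto
    let ?T = "left_translation I e h"
    let ?u = "?T (\<lambda>i s. f i s - g i s)" and ?v = "\<lambda>i s. (?T g i s - g i s) + (g i s - f i s)"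
    have TL: "?T u \<in> Lp_space p I \<rho>" if "u \<in> Lp_space p I \<rho>" for u :: "('i, 'k) family"
      by (rule translation_in_Lp_space[OF that h(1) C_nonneg[OF h(1)] bound[OF h(1)]])
    have "ae_eq I (\<lambda>i s. ?T f i s - f i s) (\<lambda>i s. ?u i s + ?v i s)"
      using translation_add[OF fgL gL h(1) C_nonneg[OF h(1)] bound[OF h(1)]]
      unfolding ae_eq_def by (auto elim!: eventually_mono)
    then have "modular p I \<rho> (\<lambda>i s. ?T f i s - f i s) = modular p I \<rho> (\<lambda>i s. ?u i s + ?v i s)"
      by (rule modular_cong)
    also have "\<dots> \<le> ennreal (2 powr p) * (modular p I \<rho> ?u + modular p I \<rho> ?v)"
      using TL[OF fgL] Lp_space_add[OF Lp_space_diff[OF TL[OF gL] gL] Lp_space_diff[OF gL f]]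
      by (intro modular_add_le) (auto simp: Lp_space_iff)
    also have "\<dots> \<le> ennreal (2 powr p) * (ennreal (C0 * \<eta>) + ennreal (2 powr p * (\<eta> + \<eta>)))"
    proof (intro mult_left_mono add_mono)
      have "modular p I \<rho> ?u \<le> ennreal (C h) * modular p I \<rho> (\<lambda>i s. f i s - g i s)"
        by (rule translation_modular_le[OF fgL h(1) C_nonneg[OF h(1)] bound[OF h(1)]])
      also have "\<dots> \<le> ennreal C0 * ennreal \<eta>"
        using C0(2)[OF h] fg by (intro mult_mono ennreal_leI) auto
      finally show "modular p I \<rho> ?u \<le> ennreal (C0 * \<eta>)"
        using C0 \<eta> by (simp add: ennreal_mult)
      have "modular p I \<rho> ?v \<le> ennreal (2 powr p) *
          (modular p I \<rho> (\<lambda>i s. ?T g i s - g i s) + modular p I \<rho> (\<lambda>i s. g i s - f i s))"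
        using Lp_space_diff[OF TL[OF gL] gL] Lp_space_diff[OF gL f]
        by (intro modular_add_le) (auto simp: Lp_space_iff)
      also have "\<dots> \<le> ennreal (2 powr p) * (ennreal \<eta> + ennreal \<eta>)"
        using elim(1) fg by (intro mult_left_mono add_mono) (auto simp: modular_minus_commute[of g f])
      also have "\<dots> = ennreal (2 powr p * (\<eta> + \<eta>))"
        unfolding ennreal_plus[OF less_imp_le[OF \<eta>] less_imp_le[OF \<eta>], symmetric]
        by (rule ennreal_mult[symmetric]) (use \<eta> in auto)
      finally show "modular p I \<rho> ?v \<le> ennreal (2 powr p * (\<eta> + \<eta>))" .
    qed simp
    also have "\<dots> = ennreal (2 powr p * (C0 * \<eta> + 2 powr p * (\<eta> + \<eta>)))"
      using \<eta> C0(1) by (simp add: ennreal_mult)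
    also have "2 powr p * (C0 * \<eta> + 2 powr p * (\<eta> + \<eta>)) = D * \<eta>"
      by (simp add: D_def algebra_simps)
    also have "D * \<eta> = \<epsilon>" using D by (simp add: \<eta>_def)
    finally show ?case .
  qed
qed

text \<open>
  By the semigroup law the increment from \<open>t\<close> to \<open>t + h\<close> is the translation by \<open>t\<close> of the increment
  from \<open>0\<close> to \<open>h\<close>.
\<close>

lemma translation_diff_modular_le:
  fixes f :: "('i, 'k::{real_normed_field, euclidean_space}) family"
  assumes f: "f \<in> Lp_space p I \<rho>" and t: "0 \<le> t" and h: "0 \<le> h"
  shows "modular p I \<rho> (\<lambda>i s. left_translation I e (t + h) f i s - left_translation I e t f i s)
    \<le> ennreal (C t) * modular p I \<rho> (\<lambda>i s. left_translation I e h f i s - f i s)"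
proof -
  let ?T = "left_translation I e"
  have ThL: "?T h f \<in> Lp_space p I \<rho>"
    by (rule translation_in_Lp_space[OF f h C_nonneg[OF h] bound[OF h]])
  have dL: "(\<lambda>i s. ?T h f i s - f i s) \<in> Lp_space p I \<rho>"
    by (rule Lp_space_diff[OF ThL f])
  have th: "0 \<le> t + h" using t h by simp
  have "ae_eq I (?T (t + h) f) (?T t (?T h f))"
    by (rule translation_semigroup[OF f t h C_nonneg[OF th] bound[OF th]])
  moreover have "ae_eq I (?T t (\<lambda>i s. (?T h f i s - f i s) + f i s))
      (\<lambda>i s. ?T t (\<lambda>i s. ?T h f i s - f i s) i s + ?T t f i s)"
    by (rule translation_add[OF dL f t C_nonneg[OF t] bound[OF t]])
  ultimately have "ae_eq I (\<lambda>i s. ?T (t + h) f i s - ?T t f i s) (?T t (\<lambda>i s. ?T h f i s - f i s))"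
    unfolding ae_eq_def by (fastforce elim: eventually_elim2)
  then have "modular p I \<rho> (\<lambda>i s. ?T (t + h) f i s - ?T t f i s) = modular p I \<rho> (?T t (\<lambda>i s. ?T h f i s - f i s))"
    by (rule modular_cong)
  also have "\<dots> \<le> ennreal (C t) * modular p I \<rho> (\<lambda>i s. ?T h f i s - f i s)"
    by (rule translation_modular_le[OF dL t C_nonneg[OF t] bound[OF t]])
  finally show ?thesis .
qed

lemma translation_continuous:
  fixes f :: "('i, 'k::{real_normed_field, euclidean_space}) family"
  assumes f: "f \<in> Lp_space p I \<rho>" and t: "0 \<le> t"
  shows "((\<lambda>s. Lp_norm p I \<rho> (\<lambda>i x. left_translation I e s f i x - left_translation I e t f i x)) \<longlongrightarrow> 0)
    (at t within {0..})"
proof -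
  let ?T = "left_translation I e"
  let ?d = "\<lambda>h. modular p I \<rho> (\<lambda>i s. ?T h f i s - f i s)"
  obtain C0 where C0: "0 \<le> C0" "\<And>s. 0 \<le> s \<Longrightarrow> s \<le> t + 1 \<Longrightarrow> C s \<le> C0"
    using C_locally_bounded[of "t + 1"] by blast
  have near: "eventually (\<lambda>s. 0 \<le> s \<and> s \<le> t + 1 \<and> s \<noteq> t) (at t within {0..})"
    unfolding eventually_at by (rule exI[of _ 1]) (auto simp: dist_real_def)
  have "filterlim (\<lambda>s. \<bar>s - t\<bar>) (at_right 0) (at t within {0..})"
    unfolding filterlim_at
  proof
    show "eventually (\<lambda>s. \<bar>s - t\<bar> \<in> {0<..} \<and> \<bar>s - t\<bar> \<noteq> 0) (at t within {0..})"
      using near by eventually_elim auto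
    have "((\<lambda>s. \<bar>s - t\<bar>) \<longlongrightarrow> \<bar>t - t\<bar>) (at t within {0..})"
      by (intro tendsto_intros)
    then show "((\<lambda>s. \<bar>s - t\<bar>) \<longlongrightarrow> 0) (at t within {0..})" by simp
  qed
  then have "((\<lambda>s. ?d \<bar>s - t\<bar>) \<longlongrightarrow> 0) (at t within {0..})"
    by (rule filterlim_compose[OF translation_tendsto_at_0[OF f]])
  then have "((\<lambda>s. ennreal C0 * ?d \<bar>s - t\<bar>) \<longlongrightarrow> ennreal C0 * 0) (at t within {0..})"
    by (intro ennreal_tendsto_cmult) auto
  then have upper: "((\<lambda>s. ennreal C0 * ?d \<bar>s - t\<bar>) \<longlongrightarrow> 0) (at t within {0..})" by simp
  have "((\<lambda>s. modular p I \<rho> (\<lambda>i x. ?T s f i x - ?T t f i x)) \<longlongrightarrow> 0) (at t within {0..})"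
  proof (rule tendsto_sandwich[OF _ _ tendsto_const upper])
    show "eventually (\<lambda>s. modular p I \<rho> (\<lambda>i x. ?T s f i x - ?T t f i x) \<le> ennreal C0 * ?d \<bar>s - t\<bar>) (at t within {0..})"
      using near
    proof eventually_elim
      case (elim s)
      \<comment> \<open>Both one-sided limits reduce to the increment that starts at the smaller of the two times.\<close>
      define a where "a = min s t"
      have a: "0 \<le> a" "a \<le> t + 1" using elim t by (auto simp: a_def)
      have "modular p I \<rho> (\<lambda>i x. ?T s f i x - ?T t f i x)
          = modular p I \<rho> (\<lambda>i x. ?T (a + \<bar>s - t\<bar>) f i x - ?T a f i x)"
      proof (cases "s \<le> t")
        case True
        then show ?thesis by (simp add: a_def modular_minus_commute[of "?T s f"])
      qed (simp add: a_def)
      also have "\<dots> \<le> ennreal (C a) * ?d \<bar>s - t\<bar>"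
        by (rule translation_diff_modular_le[OF f a(1)]) simp
      also have "\<dots> \<le> ennreal C0 * ?d \<bar>s - t\<bar>"
        by (intro mult_right_mono ennreal_leI C0(2)[OF a]) simp
      finally show ?case .
    qed
  qed simp
  then show ?thesis
    unfolding Lp_norm_eq using p_ge_1 by (intro tendsto_0_ennreal_powr) auto
qed

lemma translation_opnorm_le:
  assumes t: "0 \<le> t" and K: "0 \<le> K" and CK: "C t = K powr p"
  shows "Lp_opnorm p I \<rho> (left_translation I e t :: ('i, 'k::{real_normed_field, euclidean_space}) family \<Rightarrow> _) \<le> ennreal K"
  unfolding Lp_opnorm_def
proof (rule SUP_least, clarify)
  fix f :: "('i, 'k) family" assume f: "f \<in> Lp_space p I \<rho>" "Lp_norm p I \<rho> f \<le> 1"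
  have "modular p I \<rho> (left_translation I e t f) \<le> ennreal (C t) * modular p I \<rho> f"
    by (rule translation_modular_le[OF f(1) t C_nonneg[OF t] bound[OF t]])
  also have "\<dots> \<le> ennreal (K powr p) * 1"
    using f(2) Lp_norm_le_iff[of 1 f] CK by (intro mult_mono) auto
  finally show "Lp_norm p I \<rho> (left_translation I e t f) \<le> ennreal K"
    using K by (simp add: Lp_norm_le_iff)
qed

lemma translation_strongly_continuous_semigroup:
  assumes K: "\<And>t. 0 \<le> t \<Longrightarrow> 0 \<le> K t" and CK: "\<And>t. 0 \<le> t \<Longrightarrow> C t = K t powr p"
  shows "strongly_continuous_semigroup p I \<rho>
    (left_translation I e :: real \<Rightarrow> ('i, 'k::{real_normed_field, euclidean_space}) family \<Rightarrow> _)"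
  unfolding strongly_continuous_semigroup_def Lp_bounded_linear_def
proof (intro conjI allI impI ballI)
  fix t :: real assume t: "0 \<le> t"
  note b = t C_nonneg[OF t] bound[OF t]
  show "Lp_opnorm p I \<rho> (left_translation I e t :: ('i, 'k) family \<Rightarrow> _) < \<infinity>"
    using translation_opnorm_le[OF t K[OF t] CK[OF t]] by (rule le_less_trans) simp
  fix f :: "('i, 'k) family" assume f: "f \<in> Lp_space p I \<rho>"
  show "left_translation I e t f \<in> Lp_space p I \<rho>"
    by (rule translation_in_Lp_space[OF f b])
  show "ae_eq I (left_translation I e t (\<lambda>i s. c * f i s)) (\<lambda>i s. c * left_translation I e t f i s)" for c
    by (simp add: translation_scale ae_eq_def)
  show "((\<lambda>s. Lp_norm p I \<rho> (\<lambda>i x. left_translation I e s f i x - left_translation I e t f i x)) \<longlongrightarrow> 0) (at t within {0..})"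
    by (rule translation_continuous[OF f t])
  fix g :: "('i, 'k) family" assume g: "g \<in> Lp_space p I \<rho>"
  show "ae_eq I (left_translation I e t (\<lambda>i s. f i s + g i s)) (\<lambda>i s. left_translation I e t f i s + left_translation I e t g i s)"
    by (rule translation_add[OF f g b])
next
  fix t :: real and f g :: "('i, 'k) family"
  assume "0 \<le> t" "ae_eq I f g"
  then show "ae_eq I (left_translation I e t f) (left_translation I e t g)"
    by (intro translation_cong)
next
  fix t s :: real and f :: "('i, 'k) family"
  assume ts: "0 \<le> t" "0 \<le> s" and f: "f \<in> Lp_space p I \<rho>"
  then have st: "0 \<le> t + s" by simp
  show "ae_eq I (left_translation I e (t + s) f) (left_translation I e t (left_translation I e s f))"
    by (rule translation_semigroup[OF f ts C_nonneg[OF st] bound[OF st]])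
qed (rule translation_0)

lemma translation_defined:
  "left_translation_defined I e (Lp_space p I \<rho> :: ('i, 'k::{real_normed_field, euclidean_space}) family set)"
  unfolding left_translation_defined_def
proof (intro allI impI ballI)
  fix t :: real and f :: "('i, 'k) family" and i
  assume t: "0 \<le> t" and f: "f \<in> Lp_space p I \<rho>" and i: "i \<in> I"
  show "AE s in unit_measure. (\<lambda>j. f j (t + s - real (int_part t s))) summable_on reach I e (int_part t s) i"
    using translation_summable[OF f C_nonneg[OF t] bound[OF t] i] AE_unit_measure_in
    by eventually_elim (simp add: rot_eq[OF _ t])
qed

end

section \<open>Necessity of the pointwise condition\<close>

context weighted_edges
begin

text \<open>
  Let \<open>A\<close> be the set where the inequality fails. On the edges in \<open>F\<close> the test family has the
  prescribed values \<open>x\<close> at the points that come from \<open>A\<close>; it is zero elsewhere. At points of \<open>A\<close> its translation is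
  the sum of the \<open>x j\<close>, so the operator bound gives the reverse of the failing inequality after
  integration over \<open>A\<close>. Both sides are finite because the \<open>x j\<close> are bounded, and so \<open>A\<close> is a null set.
\<close>

lemma opnorm_bound_test_functions:
  fixes x :: "'i \<Rightarrow> real \<Rightarrow> real"
  assumes opn: "Lp_opnorm p I \<rho> (left_translation I e t :: ('i, 'k::{real_normed_field, euclidean_space}) family \<Rightarrow> _) \<le> ennreal K"
    and bl: "Lp_bounded_linear p I \<rho> (left_translation I e t :: ('i, 'k) family \<Rightarrow> _)"
    and K: "0 \<le> K" and t: "0 \<le> t" and i: "i \<in> I" and F: "finite F" "F \<subseteq> I"
    and x: "\<And>j. j \<in> F \<Longrightarrow> x j \<in> borel_measurable unit_measure" "\<And>j s. 0 \<le> x j s" "\<And>j s. x j s \<le> b"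
  shows "AE s in unit_measure. F \<subseteq> reach I e (int_part t s) i \<longrightarrow>
    (\<Sum>j\<in>F. x j (rot t s)) powr p * \<rho> i s \<le> K powr p * (\<Sum>j\<in>F. x j (rot t s) powr p * \<rho> j (rot t s))"
proof -
  define L where "L s = (\<Sum>j\<in>F. x j (rot t s)) powr p * \<rho> i s" for s
  define R where "R s = K powr p * (\<Sum>j\<in>F. x j (rot t s) powr p * \<rho> j (rot t s))" for s
  define A where "A = {s\<in>{0..<1}. F \<subseteq> reach I e (int_part t s) i \<and> R s < L s}"
  have xr: "(\<lambda>s. x j (rot t s)) \<in> borel_measurable unit_measure" if "j \<in> F" for j
    by (rule borel_measurable_rot[OF x(1)[OF that]])
  have \<rho>r: "(\<lambda>s. \<rho> j (rot t s)) \<in> borel_measurable unit_measure" if "j \<in> F" for j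
    using F that by (intro borel_measurable_rot weight_measurable) auto
  note [measurable] = weight_measurable[OF i]
  have [measurable]: "L \<in> borel_measurable unit_measure"
    unfolding L_def using borel_measurable_sum[of F "\<lambda>j s. x j (rot t s)", OF xr] by measurable
  have xp: "(\<lambda>s. x j (rot t s) powr p * \<rho> j (rot t s)) \<in> borel_measurable unit_measure" if "j \<in> F" for j
  proof -
    note [measurable] = xr[OF that] \<rho>r[OF that]
    show ?thesis by measurable
  qed
  have [measurable]: "R \<in> borel_measurable unit_measure"
    unfolding R_def using borel_measurable_sum[of F "\<lambda>j s. x j (rot t s) powr p * \<rho> j (rot t s)", OF xp] by measurable
  have A: "A \<in> sets unit_measure"
  proof -
    have "Measurable.pred unit_measure (\<lambda>s. F \<subseteq> reach I e (int_part t s) i \<and> R s < L s)"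
      by measurable
    then show ?thesis by (simp add: pred_def A_def)
  qed
  have A01: "A \<subseteq> {0..<1}" by (auto simp: A_def)
  \<comment> \<open>The inverse rotation transports the condition \<open>s \<in> A\<close> to the point \<open>rot t s\<close> at which \<open>f\<close> is evaluated.\<close>
  define f :: "('i, 'k) family" where
    "f j y = (if j \<in> F \<and> rot (- t) y \<in> A then of_real (x j y) else 0)" for j y
  let ?T = "left_translation I e t"
  have fm: "f j \<in> borel_measurable unit_measure" for j
  proof (cases "j \<in> F")
    case True
    note [measurable] = x(1)[OF True] A
    have [measurable]: "Measurable.pred unit_measure (\<lambda>y. rot (- t) y \<in> A)"
      by measurable
    show ?thesis unfolding f_def[abs_def] using True by simp
  qed (simp add: f_def[abs_def])
  have fr: "norm (f j (rot t s)) = (if s \<in> A then x j (rot t s) else 0)" if "j \<in> F" "s \<in> {0..<1}" for j s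
    using that x(2) by (simp add: f_def rot_minus_rot)
  have modf: "modular p I \<rho> f = (\<Sum>j\<in>F. \<integral>\<^sup>+s. ennreal (x j (rot t s) powr p * \<rho> j (rot t s)) * indicator A s \<partial>unit_measure)"
  proof -
    have "modular p I \<rho> f = (\<integral>\<^sup>+j. (\<integral>\<^sup>+y. ennreal (norm (f j y) powr p * \<rho> j y) \<partial>unit_measure) * indicator F j \<partial>count_space I)"
      unfolding modular_def by (intro nn_integral_cong) (auto simp: indicator_def f_def)
    also have "\<dots> = (\<Sum>j\<in>F. \<integral>\<^sup>+y. ennreal (norm (f j y) powr p * \<rho> j y) \<partial>unit_measure)"
      using F by (simp add: nn_integral_count_space_subset[symmetric] nn_integral_count_space_finite)
    also have "\<dots> = (\<Sum>j\<in>F. \<integral>\<^sup>+s. ennreal (x j (rot t s) powr p * \<rho> j (rot t s)) * indicator A s \<partial>unit_measure)"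
    proof (rule sum.cong)
      fix j assume j: "j \<in> F"
      have "(\<integral>\<^sup>+y. ennreal (norm (f j y) powr p * \<rho> j y) \<partial>unit_measure)
          = (\<integral>\<^sup>+s. ennreal (norm (f j (rot t s)) powr p * \<rho> j (rot t s)) \<partial>unit_measure)"
        using F j fm by (intro nn_integral_rot[symmetric] integrand_measurable) auto
      also have "\<dots> = (\<integral>\<^sup>+s. ennreal (x j (rot t s) powr p * \<rho> j (rot t s)) * indicator A s \<partial>unit_measure)"
        by (intro nn_integral_cong) (simp add: fr[OF j] indicator_def)
      finally show "(\<integral>\<^sup>+y. ennreal (norm (f j y) powr p * \<rho> j y) \<partial>unit_measure)
          = (\<integral>\<^sup>+s. ennreal (x j (rot t s) powr p * \<rho> j (rot t s)) * indicator A s \<partial>unit_measure)" .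
    qed simp
    finally show ?thesis .
  qed
  have xfin: "(\<integral>\<^sup>+s. ennreal (x j (rot t s) powr p * \<rho> j (rot t s)) * indicator A s \<partial>unit_measure) < \<infinity>" if "j \<in> F" for j
  proof -
    have j: "j \<in> I" using that F by blast
    have "(\<integral>\<^sup>+s. ennreal (x j (rot t s) powr p * \<rho> j (rot t s)) * indicator A s \<partial>unit_measure)
        \<le> (\<integral>\<^sup>+s. ennreal (b powr p) * ennreal (\<rho> j (rot t s)) \<partial>unit_measure)"
    proof (rule nn_integral_mono)
      fix s
      have "ennreal (x j (rot t s) powr p * \<rho> j (rot t s)) \<le> ennreal (b powr p) * ennreal (\<rho> j (rot t s))"
        using x p_ge_1 unfolding ennreal_mult'[OF powr_ge_zero]
        by (intro mult_right_mono ennreal_leI powr_mono2) auto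
      then show "ennreal (x j (rot t s) powr p * \<rho> j (rot t s)) * indicator A s \<le> ennreal (b powr p) * ennreal (\<rho> j (rot t s))"
        by (auto simp: indicator_def)
    qed
    also have "\<dots> = ennreal (b powr p) * (\<integral>\<^sup>+s. ennreal (\<rho> j s) \<partial>unit_measure)"
      using weight_measurable[OF j] \<rho>r[OF that]
      by (simp add: nn_integral_cmult nn_integral_rot[where F = "\<lambda>s. ennreal (\<rho> j s)"])
    also have "\<dots> < \<infinity>"
    proof -
      have "(\<integral>\<^sup>+s. ennreal (\<rho> j s) \<partial>unit_measure) \<le> (\<integral>\<^sup>+s. ennreal (norm (\<rho> j s)) \<partial>unit_measure)"
        by (intro nn_integral_mono ennreal_leI) simp
      also have "\<dots> < \<infinity>"
        using weight_integrable[OF j] by (simp add: integrable_iff_bounded)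
      finally show ?thesis by (simp add: ennreal_mult_less_top)
    qed
    finally show ?thesis .
  qed
  have fL: "f \<in> Lp_space p I \<rho>"
    unfolding Lp_space_iff modf using fm xfin F(1) by simp
  have TfL: "?T f \<in> Lp_space p I \<rho>"
    using bl fL by (simp add: Lp_bounded_linear_def)
  have "modular p I \<rho> (?T f) \<le> ennreal (K powr p) * modular p I \<rho> f"
    using TfL by (intro modular_le_of_opnorm_le[OF opn K fL]) (auto simp: Lp_space_iff translation_scale)
  moreover have "(\<integral>\<^sup>+s. ennreal (L s) * indicator A s \<partial>unit_measure) \<le> modular p I \<rho> (?T f)"
  proof -
    have "(\<integral>\<^sup>+s. ennreal (L s) * indicator A s \<partial>unit_measure)
        \<le> (\<integral>\<^sup>+s. ennreal (norm (?T f i s) powr p * \<rho> i s) \<partial>unit_measure)"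
    proof (rule nn_integral_mono)
      fix s assume "s \<in> space unit_measure"
      then have s: "s \<in> {0..<1}" by simp
      show "ennreal (L s) * indicator A s \<le> ennreal (norm (?T f i s) powr p * \<rho> i s)"
      proof (cases "s \<in> A")
        case True
        then have FJ: "F \<subseteq> reach I e (int_part t s) i" by (simp add: A_def)
        have "?T f i s = (\<Sum>\<^sub>\<infinity>j\<in>reach I e (int_part t s) i. f j (rot t s))"
          by (rule left_translation_eq[OF s t])
        also have "\<dots> = (\<Sum>\<^sub>\<infinity>j\<in>F. f j (rot t s))"
          by (rule infsum_cong_neutral) (use FJ in \<open>auto simp: f_def\<close>)
        also have "\<dots> = of_real (\<Sum>j\<in>F. x j (rot t s))"
          using F(1) True s by (simp add: f_def rot_minus_rot)
        finally have "norm (?T f i s) = (\<Sum>j\<in>F. x j (rot t s))"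
          using x(2) by (simp add: sum_nonneg del: of_real_sum)
        then show ?thesis by (simp add: L_def True)
      qed simp
    qed
    also have "\<dots> \<le> modular p I \<rho> (?T f)"
      unfolding modular_def
      by (subst infsum_ennreal_eq_nn_integral[OF countable_edges, symmetric])
        (use finite_sum_le_infsum_ennreal[of "{i}" I] i in auto)
    finally show ?thesis .
  qed
  moreover have modR: "ennreal (K powr p) * modular p I \<rho> f = (\<integral>\<^sup>+s. ennreal (R s) * indicator A s \<partial>unit_measure)"
  proof -
    have "ennreal (K powr p) * modular p I \<rho> f
        = (\<integral>\<^sup>+s. ennreal (K powr p) * (\<Sum>j\<in>F. ennreal (x j (rot t s) powr p * \<rho> j (rot t s)) * indicator A s) \<partial>unit_measure)"
      unfolding modf using xp A by (simp add: nn_integral_sum nn_integral_cmult)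
    also have "\<dots> = (\<integral>\<^sup>+s. ennreal (R s) * indicator A s \<partial>unit_measure)"
    proof (rule nn_integral_cong_AE)
      show "AE s in unit_measure. ennreal (K powr p) * (\<Sum>j\<in>F. ennreal (x j (rot t s) powr p * \<rho> j (rot t s)) * indicator A s)
          = ennreal (R s) * indicator A s"
        using AE_weight_rot_pos[of t]
      proof eventually_elim
        case (elim s)
        have "(\<Sum>j\<in>F. ennreal (x j (rot t s) powr p * \<rho> j (rot t s))) = ennreal (\<Sum>j\<in>F. x j (rot t s) powr p * \<rho> j (rot t s))"
          using elim F by (intro sum_ennreal) (auto simp: subset_iff less_imp_le)
        then show ?case
          unfolding sum_distrib_right[symmetric] R_def
          by (simp only: ennreal_mult'[OF powr_ge_zero, of K p] mult.assoc)
      qed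
    qed
    finally show ?thesis .
  qed
  ultimately have int_le: "(\<integral>\<^sup>+s. ennreal (L s) * indicator A s \<partial>unit_measure) \<le> (\<integral>\<^sup>+s. ennreal (R s) * indicator A s \<partial>unit_measure)"
    by simp
  have Rnn: "AE s in unit_measure. 0 \<le> R s"
    using AE_weight_rot_pos[of t]
    by eventually_elim (use F in \<open>auto simp: R_def less_imp_le subset_iff intro!: mult_nonneg_nonneg sum_nonneg\<close>)
  have "(\<integral>\<^sup>+s. ennreal (R s) * indicator A s \<partial>unit_measure) \<noteq> \<infinity>"
    using fL modR by (metis Lp_space_iff ennreal_mult_less_top ennreal_less_top infinity_ennreal_def less_irrefl)
  moreover have "AE s in unit_measure. ennreal (R s) * indicator A s \<le> ennreal (L s) * indicator A s"
    by (rule AE_I2) (auto simp: A_def indicator_def intro!: ennreal_leI)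
  moreover have [measurable]: "(\<lambda>s. ennreal (L s) * indicator A s) \<in> borel_measurable unit_measure"
    "(\<lambda>s. ennreal (R s) * indicator A s) \<in> borel_measurable unit_measure"
    using A by measurable
  ultimately have "(\<integral>\<^sup>+s. ennreal (L s) * indicator A s - ennreal (R s) * indicator A s \<partial>unit_measure) = 0"
    using int_le by (subst nn_integral_diff) (auto simp: less_top intro!: diff_eq_0_ennreal le_less_trans[OF int_le])
  then have "AE s in unit_measure. ennreal (L s) * indicator A s - ennreal (R s) * indicator A s = 0"
    by (subst (asm) nn_integral_0_iff_AE) measurable
  then show ?thesis
    using Rnn AE_unit_measure_in
  proof eventually_elim
    case (elim s)
    show ?case
      unfolding L_def[symmetric] R_def[symmetric]
    proof (intro impI, rule ccontr)
      assume "F \<subseteq> reach I e (int_part t s) i" "\<not> L s \<le> R s"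
      then have "s \<in> A" using elim by (simp add: A_def)
      with elim(1) have "ennreal (L s) - ennreal (R s) = 0" by simp
      then have "ennreal (L s) \<le> ennreal (R s)"
        by (simp add: ennreal_minus_eq_0)
      then show False using \<open>\<not> L s \<le> R s\<close> elim(2) by simp
    qed
  qed
qed

text \<open>
  The extremal vector of Hoelder's inequality is an unbounded function of the position, so it is cut off
  at each level \<open>n\<close>. At any given point a finite part of a fibre is untouched by the cutoff once \<open>n\<close> is large,
  and countably many exceptional null sets suffice because there are only countably many finite sets of edges.
\<close>

lemma extremal_bound_of_opnorm:
  fixes u :: "'i \<Rightarrow> real \<Rightarrow> real"
  assumes opn: "Lp_opnorm p I \<rho> (left_translation I e t :: ('i, 'k::{real_normed_field, euclidean_space}) family \<Rightarrow> _) \<le> ennreal K"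
    and bl: "Lp_bounded_linear p I \<rho> (left_translation I e t :: ('i, 'k) family \<Rightarrow> _)"
    and K: "0 \<le> K" and t: "0 \<le> t" and i: "i \<in> I"
    and u: "\<And>j. j \<in> I \<Longrightarrow> u j \<in> borel_measurable unit_measure" "\<And>j s. 0 \<le> u j s"
  shows "AE s in unit_measure. \<forall>F. finite F \<and> F \<subseteq> reach I e (int_part t s) i \<longrightarrow>
    (\<Sum>j\<in>F. u j (rot t s)) powr p * \<rho> i s \<le> K powr p * (\<Sum>j\<in>F. u j (rot t s) powr p * \<rho> j (rot t s))"
proof -
  define v where "v n j s = (if u j s \<le> real n then u j s else 0)" for n :: nat and j s
  have "AE s in unit_measure. \<forall>F\<in>{F. finite F \<and> F \<subseteq> I}. \<forall>n. F \<subseteq> reach I e (int_part t s) i \<longrightarrow>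
    (\<Sum>j\<in>F. v n j (rot t s)) powr p * \<rho> i s \<le> K powr p * (\<Sum>j\<in>F. v n j (rot t s) powr p * \<rho> j (rot t s))"
  proof (subst AE_ball_countable)
    show "countable {F. finite F \<and> F \<subseteq> I}"
      using countable_Collect_finite_subset[OF countable_edges] by (simp add: conj_commute)
    show "\<forall>F\<in>{F. finite F \<and> F \<subseteq> I}. AE s in unit_measure. \<forall>n. F \<subseteq> reach I e (int_part t s) i \<longrightarrow>
      (\<Sum>j\<in>F. v n j (rot t s)) powr p * \<rho> i s \<le> K powr p * (\<Sum>j\<in>F. v n j (rot t s) powr p * \<rho> j (rot t s))"
      unfolding AE_all_countable
    proof (intro ballI allI)
      fix F n assume "F \<in> {F. finite F \<and> F \<subseteq> I}"
      then have F: "finite F" "F \<subseteq> I" by auto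
      show "AE s in unit_measure. F \<subseteq> reach I e (int_part t s) i \<longrightarrow>
        (\<Sum>j\<in>F. v n j (rot t s)) powr p * \<rho> i s \<le> K powr p * (\<Sum>j\<in>F. v n j (rot t s) powr p * \<rho> j (rot t s))"
      proof (rule opnorm_bound_test_functions[OF opn bl K t i F])
        fix j assume "j \<in> F"
        then have [measurable]: "u j \<in> borel_measurable unit_measure" using F u(1) by blast
        show "v n j \<in> borel_measurable unit_measure" unfolding v_def[abs_def] by measurable
      qed (auto simp: v_def u(2))
    qed
  qed
  then show ?thesis
  proof (rule eventually_mono, intro allI impI)
    fix s F
    assume h: "\<forall>F\<in>{F. finite F \<and> F \<subseteq> I}. \<forall>n. F \<subseteq> reach I e (int_part t s) i \<longrightarrow>
      (\<Sum>j\<in>F. v n j (rot t s)) powr p * \<rho> i s \<le> K powr p * (\<Sum>j\<in>F. v n j (rot t s) powr p * \<rho> j (rot t s))"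
    assume F: "finite F \<and> F \<subseteq> reach I e (int_part t s) i"
    then have FI: "F \<subseteq> I" using reach_subset by blast
    define n where "n = nat \<lceil>\<Sum>j\<in>F. u j (rot t s)\<rceil>"
    have "v n j (rot t s) = u j (rot t s)" if "j \<in> F" for j
    proof -
      have "u j (rot t s) \<le> (\<Sum>j\<in>F. u j (rot t s))"
        using F that u(2) by (intro member_le_sum) auto
      then have "u j (rot t s) \<le> real n" unfolding n_def by linarith
      then show ?thesis by (simp add: v_def)
    qed
    then have eq: "(\<Sum>j\<in>F. v n j (rot t s)) = (\<Sum>j\<in>F. u j (rot t s))"
      "(\<Sum>j\<in>F. v n j (rot t s) powr p * \<rho> j (rot t s)) = (\<Sum>j\<in>F. u j (rot t s) powr p * \<rho> j (rot t s))"
      by (auto intro: sum.cong)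
    have "(\<Sum>j\<in>F. v n j (rot t s)) powr p * \<rho> i s \<le> K powr p * (\<Sum>j\<in>F. v n j (rot t s) powr p * \<rho> j (rot t s))"
      using h F FI by blast
    then show "(\<Sum>j\<in>F. u j (rot t s)) powr p * \<rho> i s \<le> K powr p * (\<Sum>j\<in>F. u j (rot t s) powr p * \<rho> j (rot t s))"
      unfolding eq .
  qed
qed

section \<open>The characterization\<close>

lemma semigroup_of_pointwise_bound:
  assumes M: "0 < M" and bound: "\<And>t. 0 \<le> t \<Longrightarrow> pointwise_bound ((M * exp (w * t)) powr p) t"
  shows "left_translation_defined I e (Lp_space p I \<rho> :: ('i, 'k::{real_normed_field, euclidean_space}) family set)"
    and "strongly_continuous_semigroup p I \<rho> (left_translation I e :: real \<Rightarrow> ('i, 'k) family \<Rightarrow> _)"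
    and "0 \<le> t \<Longrightarrow> Lp_opnorm p I \<rho> (left_translation I e t :: ('i, 'k) family \<Rightarrow> _) \<le> ennreal (M * exp (w * t))"
proof -
  interpret bounded_translation I e \<rho> p "\<lambda>t. (M * exp (w * t)) powr p"
  proof unfold_locales
    fix b :: real
    have "(M * exp (w * t)) powr p \<le> (M * exp (\<bar>w\<bar> * \<bar>b\<bar>)) powr p" if "0 \<le> t" "t \<le> b" for t
    proof -
      have "w * t \<le> \<bar>w\<bar> * \<bar>b\<bar>"
        using that by (intro mult_mono) auto
      then show ?thesis
        using M p_ge_1 by (intro powr_mono2 mult_left_mono) auto
    qed
    then show "\<exists>C0\<ge>0. \<forall>t. 0 \<le> t \<longrightarrow> t \<le> b \<longrightarrow> (M * exp (w * t)) powr p \<le> C0"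
      by (intro exI[of _ "(M * exp (\<bar>w\<bar> * \<bar>b\<bar>)) powr p"]) auto
  qed (use bound in auto)
  show "left_translation_defined I e (Lp_space p I \<rho> :: ('i, 'k) family set)"
    by (rule translation_defined)
  show "strongly_continuous_semigroup p I \<rho> (left_translation I e :: real \<Rightarrow> ('i, 'k) family \<Rightarrow> _)"
    by (rule translation_strongly_continuous_semigroup[where K = "\<lambda>t. M * exp (w * t)"]) (use M in auto)
  show "Lp_opnorm p I \<rho> (left_translation I e t :: ('i, 'k) family \<Rightarrow> _) \<le> ennreal (M * exp (w * t))" if "0 \<le> t"
    by (rule translation_opnorm_le[OF that]) (use M in auto)
qed

end

theorem proposition2p2:
  fixes V :: "'v set" and E :: "('v \<times> 'v) set"
    and I :: "'i set" and e :: "'i \<Rightarrow> 'v \<times> 'v"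
    and \<rho> :: "('i, real) family"
    and M w :: real
    and X :: "real \<Rightarrow> ('i, 'k::{real_normed_field, euclidean_space}) family set"
    and T :: "real \<Rightarrow> ('i, 'k) family \<Rightarrow> ('i, 'k) family"
  assumes "directed_tree V E"
    and "bij_betw e I E"
    and "weight I \<rho>"
    and "M \<ge> 1"
    and "X = (\<lambda>p. Lp_space p I \<rho>)"
    and "T = left_translation I e"
  shows
    "((left_translation_defined I e (X 1) \<and>
      strongly_continuous_semigroup 1 I \<rho> T \<and>
      (\<forall>t\<ge>0. Lp_opnorm 1 I \<rho> (T t) \<le> ennreal (M * exp (w * t))))
     \<longleftrightarrow>
     (\<forall>i\<in>I. \<forall>t\<ge>0. AE s in unit_measure.
        ereal (\<rho> i s) \<le>
          ereal (M * exp (w * t)) *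
          (INF j\<in>reach I e (int_part t s) i. ereal (\<rho> j (s + t - real (int_part t s))))))
     \<and>
     (\<forall>p>1.
      (left_translation_defined I e (X p) \<and>
      strongly_continuous_semigroup p I \<rho> T \<and>
      (\<forall>t\<ge>0. Lp_opnorm p I \<rho> (T t) \<le> ennreal (M * exp (w * t))))
     \<longleftrightarrow>
     (\<forall>i\<in>I. \<forall>t\<ge>0. AE s in unit_measure.
        ennreal_powr
          (\<Sum>\<^sub>\<infinity>j\<in>reach I e (int_part t s) i.
             ennreal (1 / \<rho> j (s + t - real (int_part t s)) powr (1 / (p - 1))))
          (p - 1)
        \<le> ennreal (M powr p * exp (p * w * t) * (1 / \<rho> i s))))"
  (is "(?L1 \<longleftrightarrow> ?R1) \<and> (\<forall>p>1. ?Lp p \<longleftrightarrow> ?Rp p)")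
proof -
  interpret forward_edges I e
    using assms(1,2) by (rule directed_tree_forward_edges)
  have edges: "weighted_edges I e \<rho> p" if "1 \<le> p" for p
    by unfold_locales (use assms(3) that in auto)
  have M: "0 < M" using assms(4) by simp
  have K: "0 < M * exp (w * t)" for t using M by simp
  have rot: "s + t - real (int_part t s) = rot t s" if "s \<in> {0..<1}" "0 \<le> t" for s t
    using rot_eq[OF that] by (simp add: add.commute)
  have K_powr: "(M * exp (w * t)) powr p = M powr p * exp (p * w * t)" for p t
    using M by (simp add: powr_mult) (simp add: powr_def mult.assoc)
  have bl: "Lp_bounded_linear p I \<rho> (left_translation I e t :: ('i, 'k) family \<Rightarrow> _)"
    if "strongly_continuous_semigroup p I \<rho> T" "0 \<le> t" for p t
    using that by (simp add: strongly_continuous_semigroup_def assms(6))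
  have "?L1 \<longleftrightarrow> ?R1"
  proof
    interpret weighted_edges I e \<rho> 1 by (rule edges) simp
    assume L: ?L1
    show ?R1
    proof (intro ballI allI impI)
      fix i and t :: real assume i: "i \<in> I" and t: "0 \<le> t"
      have opn: "Lp_opnorm 1 I \<rho> (left_translation I e t :: ('i, 'k) family \<Rightarrow> _) \<le> ennreal (M * exp (w * t))"
        using L t by (simp add: assms(6))
      have "AE s in unit_measure. \<forall>F. finite F \<and> F \<subseteq> reach I e (int_part t s) i \<longrightarrow>
          (\<Sum>j\<in>F. 1) powr 1 * \<rho> i s \<le> (M * exp (w * t)) powr 1 * (\<Sum>j\<in>F. 1 powr 1 * \<rho> j (rot t s))"
        using L t by (intro extremal_bound_of_opnorm[OF opn bl less_imp_le[OF K] t i, where u = "\<lambda>_ _. 1"]) auto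
      then show "AE s in unit_measure. ereal (\<rho> i s) \<le> ereal (M * exp (w * t)) *
          (INF j\<in>reach I e (int_part t s) i. ereal (\<rho> j (s + t - real (int_part t s))))"
        using AE_unit_measure_in
      proof eventually_elim
        case (elim s)
        have "\<rho> i s \<le> M * exp (w * t) * \<rho> j (rot t s)" if "j \<in> reach I e (int_part t s) i" for j
          using elim(1)[rule_format, of "{j}"] that K[of t] by simp
        then show ?case
          unfolding le_cmult_INF_iff[OF K] using elim t by (simp add: rot)
      qed
    qed
  next
    interpret weighted_edges I e \<rho> 1 by (rule edges) simp
    assume R: ?R1
    have "pointwise_bound ((M * exp (w * t)) powr 1) t" if t: "0 \<le> t" for t
    proof
      fix i assume i: "i \<in> I"
      have "AE s in unit_measure. ereal (\<rho> i s) \<le> ereal (M * exp (w * t)) *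
          (INF j\<in>reach I e (int_part t s) i. ereal (\<rho> j (s + t - real (int_part t s))))"
        using R i t by blast
      then show "AE s in unit_measure. fibre_bound 1 ((M * exp (w * t)) powr 1)
          (reach I e (int_part t s) i) (\<lambda>j. \<rho> j (rot t s)) (\<rho> i s)"
        using AE_unit_measure_in AE_weight_pos AE_weight_rot_pos[of t]
      proof eventually_elim
        case (elim s)
        show ?case
        proof (rule fibre_bound_1)
          show "0 \<le> \<rho> i s" using elim i by (simp add: less_imp_le)
          fix j assume j: "j \<in> reach I e (int_part t s) i"
          then have "j \<in> I" using reach_subset by blast
          then show "0 \<le> \<rho> j (rot t s)" using elim by (simp add: less_imp_le)
          show "\<rho> i s \<le> (M * exp (w * t)) powr 1 * \<rho> j (rot t s)"
            using elim(1) j K[of t] unfolding le_cmult_INF_iff[OF K] rot[OF elim(2) t] by simp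
        qed
      qed
    qed
    from semigroup_of_pointwise_bound[OF M this] show ?L1
      unfolding assms(5,6) by blast
  qed
  moreover have "?Lp p \<longleftrightarrow> ?Rp p" if p: "1 < p" for p
  proof
    interpret weighted_edges I e \<rho> p by (rule edges) (use p in simp)
    assume L: "?Lp p"
    show "?Rp p"
    proof (intro ballI allI impI)
      fix i and t :: real assume i: "i \<in> I" and t: "0 \<le> t"
      define u where "u j s = 1 / \<rho> j s powr (1 / (p - 1))" for j s
      have opn: "Lp_opnorm p I \<rho> (left_translation I e t :: ('i, 'k) family \<Rightarrow> _) \<le> ennreal (M * exp (w * t))"
        using L t by (simp add: assms(6))
      have u_nonneg: "0 \<le> u j s" for j s by (simp add: u_def)
      have "u j \<in> borel_measurable unit_measure" if "j \<in> I" for j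
      proof -
        note [measurable] = weight_measurable[OF that]
        show ?thesis unfolding u_def[abs_def] by measurable
      qed
      then have "AE s in unit_measure. \<forall>F. finite F \<and> F \<subseteq> reach I e (int_part t s) i \<longrightarrow>
          (\<Sum>j\<in>F. u j (rot t s)) powr p * \<rho> i s
          \<le> (M * exp (w * t)) powr p * (\<Sum>j\<in>F. u j (rot t s) powr p * \<rho> j (rot t s))"
        using L t by (intro extremal_bound_of_opnorm[OF opn bl less_imp_le[OF K] t i])
          (simp_all add: u_nonneg)
      then show "AE s in unit_measure. ennreal_powr (\<Sum>\<^sub>\<infinity>j\<in>reach I e (int_part t s) i.
             ennreal (1 / \<rho> j (s + t - real (int_part t s)) powr (1 / (p - 1)))) (p - 1)
        \<le> ennreal (M powr p * exp (p * w * t) * (1 / \<rho> i s))"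
        using AE_unit_measure_in AE_weight_pos AE_weight_rot_pos[of t]
      proof eventually_elim
        case (elim s)
        have pos: "0 < \<rho> j (rot t s)" if "j \<in> reach I e (int_part t s) i" for j
          using that reach_subset elim(4) by blast
        show ?case
          unfolding rot[OF elim(2) t] u_def[symmetric] K_powr[symmetric]
          by (rule dual_sum_le_if_extremal_bound[OF p, where r = "\<lambda>j. \<rho> j (rot t s)"])
            (use elim(1,3) i pos in \<open>auto simp: u_def\<close>)
      qed
    qed
  next
    interpret weighted_edges I e \<rho> p by (rule edges) (use p in simp)
    assume R: "?Rp p"
    have "pointwise_bound ((M * exp (w * t)) powr p) t" if t: "0 \<le> t" for t
    proof
      fix i assume i: "i \<in> I"
      have "AE s in unit_measure. ennreal_powr (\<Sum>\<^sub>\<infinity>j\<in>reach I e (int_part t s) i.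
             ennreal (1 / \<rho> j (s + t - real (int_part t s)) powr (1 / (p - 1)))) (p - 1)
        \<le> ennreal (M powr p * exp (p * w * t) * (1 / \<rho> i s))"
        using R i t by blast
      then show "AE s in unit_measure. fibre_bound p ((M * exp (w * t)) powr p)
          (reach I e (int_part t s) i) (\<lambda>j. \<rho> j (rot t s)) (\<rho> i s)"
        using AE_unit_measure_in AE_weight_pos AE_weight_rot_pos[of t]
      proof eventually_elim
        case (elim s)
        show ?case
        proof (rule fibre_bound_if_dual_sum_le[OF p])
          show "0 < \<rho> j (rot t s)" if "j \<in> reach I e (int_part t s) i" for j
            using that reach_subset elim(4) by blast
          show "ennreal_powr (\<Sum>\<^sub>\<infinity>j\<in>reach I e (int_part t s) i. ennreal (1 / \<rho> j (rot t s) powr (1 / (p - 1)))) (p - 1)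
              \<le> ennreal ((M * exp (w * t)) powr p * (1 / \<rho> i s))"
            using elim(1) unfolding rot[OF elim(2) t] K_powr .
        qed (use elim(3) i in auto)
      qed
    qed
    from semigroup_of_pointwise_bound[OF M this] show "?Lp p"
      unfolding assms(5,6) by blast
  qed
  ultimately show ?thesis by blast
qed

end
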